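(* Let $\Gamma$ and $H$ be groups, with $H$ nontrivial, let $X$ be a graph, and let $\Gamma\curvearrowright_{\alpha}X$ be an action by graph automorphisms. Then the graph wreath product $\mathcal{W}(\Gamma,H,X)$ is a LEF group if and only if $\Gamma$ and $H$ are LEF groups and $\Gamma\curvearrowright_{\alpha}X$ is a LEF action on the graph $X$.
   Context: Graph wreath product. For a graph $X=(V,E)$ and a group $H$, let $H_v$ ($v\in V$) be copies of $H$ and $P(H,X)=(\ast_{v\in V}H_v)/\langle\langle h^{-1}k^{-1}hk:(v,w)\in E,\ h\in H_v,\ k\in H_w\rangle\rangle$. An action $\Gamma\curvearrowright_\alpha X$ by graph automorphisms induces an action $\hat\alpha$ on $P(H,X)$ by automorphisms, where $g$ sends $H_v$ identically to $H_{\alpha(g)v}$, and $\mathcal{W}(\Gamma,H,X)=P(H,X)\rtimes_{\hat\alpha}\Gamma$. A group $\Gamma$ is LEF (locally embeddable into finite groups) if for every finite $A\subseteq\Gamma$ there are a finite group $Q$ and an injective function $\phi:A\to Q$ with $\phi(gh)=\phi(g)\phi(h)$ whenever $g,h,gh\in A$. An action $\Gamma\curvearrowright_\alpha X$ by automorphisms on a graph is a LEF action if for all finite $F\subseteq\Gamma$ and finite induced subgraphs $Z\subseteq X$ there exist a finite group $Q$, a finite graph $Y$, an action $Q\curvearrowright_\beta Y$ by graph automorphisms, and functions $\rho:\Gamma\to Q$, $\pi:Z\to Y$, with $\pi$ an inclusion of an induced subgraph (an injective vertex map preserving adjacency and non-adjacency), such that (i) for all $g,h\in F$ with $gh\in F$,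 $\rho(gh)=\rho(g)\rho(h)$; (ii) if $g\in F$ and $x\in Z$ is a vertex such that $\alpha(g)\cdot x\in Z$, then $\pi(\alpha(g)\cdot x)=\beta(\rho(g))\cdot\pi(x)$. *)

theory Defs
  imports "HOL-Algebra.Group_Action" "HOL-Algebra.Generated_Groups" "Graph_Theory.Pair_Digraph"
begin

text \<open>
  A graph is a simple undirected graph, possibly infinite: \<^locale>\<open>pair_bidirected_digraph\<close>
  (symmetric loop-free edge relation on the vertex set). Finite such graphs are \<^locale>\<open>pair_graph\<close>.
\<close>

section \<open>Free products\<close>

text \<open>
  The free product of the family \<open>G i\<close>, \<open>i \<in> I\<close>, consists of the words in letters \<open>(i, x)\<close> with
  \<open>x \<in> carrier (G i)\<close>, modulo deleting identity letters and multiplying adjacent letters that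
  belong to the same factor.
\<close>

definition words :: "'i set \<Rightarrow> ('i \<Rightarrow> ('a, 'b) monoid_scheme) \<Rightarrow> ('i \<times> 'a) list set" where
  "words I G = lists (SIGMA i:I. carrier (G i))"

inductive_set free_product_rel ::
  "'i set \<Rightarrow> ('i \<Rightarrow> ('a, 'b) monoid_scheme) \<Rightarrow> (('i \<times> 'a) list \<times> ('i \<times> 'a) list) set"
  for I :: "'i set" and G :: "'i \<Rightarrow> ('a, 'b) monoid_scheme" where
  refl: "w \<in> words I G \<Longrightarrow> (w, w) \<in> free_product_rel I G"
| sym: "(u, w) \<in> free_product_rel I G \<Longrightarrow> (w, u) \<in> free_product_rel I G"
| trans: "(u, v) \<in> free_product_rel I G \<Longrightarrow> (v, w) \<in> free_product_rel I G \<Longrightarrow>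
    (u, w) \<in> free_product_rel I G"
| one: "u \<in> words I G \<Longrightarrow> w \<in> words I G \<Longrightarrow> i \<in> I \<Longrightarrow>
    (u @ [(i, \<one>\<^bsub>G i\<^esub>)] @ w, u @ w) \<in> free_product_rel I G"
| mult: "u \<in> words I G \<Longrightarrow> w \<in> words I G \<Longrightarrow> i \<in> I \<Longrightarrow>
    x \<in> carrier (G i) \<Longrightarrow> y \<in> carrier (G i) \<Longrightarrow>
    (u @ [(i, x), (i, y)] @ w, u @ [(i, x \<otimes>\<^bsub>G i\<^esub> y)] @ w) \<in> free_product_rel I G"

definition free_product ::
  "'i set \<Rightarrow> ('i \<Rightarrow> ('a, 'b) monoid_scheme) \<Rightarrow> ('i \<times> 'a) list set monoid" where
  "free_product I G =
    \<lparr>carrier = words I G // free_product_rel I G,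
     monoid.mult = (\<lambda>A B. free_product_rel I G `` {u @ w | u w. u \<in> A \<and> w \<in> B}),
     one = free_product_rel I G `` {[]}\<rparr>"

definition free_product_incl ::
  "'i set \<Rightarrow> ('i \<Rightarrow> ('a, 'b) monoid_scheme) \<Rightarrow> 'i \<Rightarrow> 'a \<Rightarrow> ('i \<times> 'a) list set" where
  "free_product_incl I G i x = free_product_rel I G `` {[(i, x)]}"

section \<open>Graph wreath products\<close>

definition normal_closure :: "('a, 'b) monoid_scheme \<Rightarrow> 'a set \<Rightarrow> 'a set" where
  "normal_closure G S =
    generate G {x \<otimes>\<^bsub>G\<^esub> s \<otimes>\<^bsub>G\<^esub> inv\<^bsub>G\<^esub> x | x s. x \<in> carrier G \<and> s \<in> S}"

definition edge_commutators ::
  "('h, 'b) monoid_scheme \<Rightarrow> 'v pair_pre_digraph \<Rightarrow> ('v \<times> 'h) list set set" where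
  "edge_commutators H X =
    (let P = free_product (pverts X) (\<lambda>_. H);
         \<iota> = free_product_incl (pverts X) (\<lambda>_. H)
     in {inv\<^bsub>P\<^esub> (\<iota> v h) \<otimes>\<^bsub>P\<^esub> inv\<^bsub>P\<^esub> (\<iota> w k) \<otimes>\<^bsub>P\<^esub> \<iota> v h \<otimes>\<^bsub>P\<^esub> \<iota> w k
         | v w h k. (v, w) \<in> parcs X \<and> h \<in> carrier H \<and> k \<in> carrier H})"

definition graph_product ::
  "('h, 'b) monoid_scheme \<Rightarrow> 'v pair_pre_digraph \<Rightarrow> ('v \<times> 'h) list set set monoid" where
  "graph_product H X =
    (let P = free_product (pverts X) (\<lambda>_. H) in P Mod normal_closure P (edge_commutators H X))"

definition graph_action ::
  "('g, 'c) monoid_scheme \<Rightarrow> 'v pair_pre_digraph \<Rightarrow> ('g \<Rightarrow> 'v \<Rightarrow> 'v) \<Rightarrow> bool" where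
  "graph_action \<Gamma> X \<alpha> \<longleftrightarrow>
    group_action \<Gamma> (pverts X) \<alpha> \<and>
    (\<forall>g\<in>carrier \<Gamma>. \<forall>v\<in>pverts X. \<forall>w\<in>pverts X.
      (\<alpha> g v, \<alpha> g w) \<in> parcs X \<longleftrightarrow> (v, w) \<in> parcs X)"

text \<open>
  An element of the graph product is a coset, i.e. a set of equivalence classes of words. The
  induced automorphism relabels every letter \<open>(v, h)\<close> to \<open>(\<alpha> g v, h)\<close> in all of these words; since
  \<open>\<alpha> g\<close> is a graph automorphism, the resulting set is again a coset.
\<close>

definition induced_action ::
  "('g \<Rightarrow> 'v \<Rightarrow> 'v) \<Rightarrow> 'g \<Rightarrow> ('v \<times> 'h) list set set \<Rightarrow> ('v \<times> 'h) list set set" where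
  "induced_action \<alpha> g C = (\<lambda>A. map (\<lambda>(v, h). (\<alpha> g v, h)) ` A) ` C"

definition semidirect_product ::
  "('n, 'b) monoid_scheme \<Rightarrow> ('g, 'c) monoid_scheme \<Rightarrow> ('g \<Rightarrow> 'n \<Rightarrow> 'n) \<Rightarrow> ('n \<times> 'g) monoid" where
  "semidirect_product N G \<theta> =
    \<lparr>carrier = carrier N \<times> carrier G,
     monoid.mult = (\<lambda>(n, g) (m, h). (n \<otimes>\<^bsub>N\<^esub> \<theta> g m, g \<otimes>\<^bsub>G\<^esub> h)),
     one = (\<one>\<^bsub>N\<^esub>, \<one>\<^bsub>G\<^esub>)\<rparr>"

definition graph_wreath_product ::
  "('g, 'c) monoid_scheme \<Rightarrow> ('h, 'b) monoid_scheme \<Rightarrow> 'v pair_pre_digraph \<Rightarrow>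
    ('g \<Rightarrow> 'v \<Rightarrow> 'v) \<Rightarrow> (('v \<times> 'h) list set set \<times> 'g) monoid" where
  "graph_wreath_product \<Gamma> H X \<alpha> = semidirect_product (graph_product H X) \<Gamma> (induced_action \<alpha>)"

section \<open>LEF groups and LEF actions\<close>

text \<open>
  Finite groups and finite graphs are taken with underlying sets of natural numbers; every finite
  group or graph is isomorphic to one of this form.
\<close>

definition LEF_group :: "('a, 'b) monoid_scheme \<Rightarrow> bool" where
  "LEF_group G \<longleftrightarrow> group G \<and>
    (\<forall>A. finite A \<and> A \<subseteq> carrier G \<longrightarrow>
      (\<exists>(Q :: nat monoid) \<phi>. group Q \<and> finite (carrier Q) \<and>
        \<phi> \<in> A \<rightarrow> carrier Q \<and> inj_on \<phi> A \<and>
        (\<forall>g\<in>A. \<forall>h\<in>A. g \<otimes>\<^bsub>G\<^esub> h \<in> A \<longrightarrow> \<phi> (g \<otimes>\<^bsub>G\<^esub> h) = \<phi> g \<otimes>\<^bsub>Q\<^esub> \<phi> h)))"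

text \<open>A finite induced subgraph is given by its vertex set \<open>Z\<close>.\<close>

definition LEF_action ::
  "('g, 'c) monoid_scheme \<Rightarrow> 'v pair_pre_digraph \<Rightarrow> ('g \<Rightarrow> 'v \<Rightarrow> 'v) \<Rightarrow> bool" where
  "LEF_action \<Gamma> X \<alpha> \<longleftrightarrow> graph_action \<Gamma> X \<alpha> \<and>
    (\<forall>F Z. finite F \<and> F \<subseteq> carrier \<Gamma> \<and> finite Z \<and> Z \<subseteq> pverts X \<longrightarrow>
      (\<exists>(Q :: nat monoid) (Y :: nat pair_pre_digraph) \<beta> \<rho> \<pi>.
        group Q \<and> finite (carrier Q) \<and> pair_graph Y \<and> graph_action Q Y \<beta> \<and>
        \<rho> \<in> carrier \<Gamma> \<rightarrow> carrier Q \<and>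
        \<pi> \<in> Z \<rightarrow> pverts Y \<and> inj_on \<pi> Z \<and>
        (\<forall>x\<in>Z. \<forall>y\<in>Z. (\<pi> x, \<pi> y) \<in> parcs Y \<longleftrightarrow> (x, y) \<in> parcs X) \<and>
        (\<forall>g\<in>F. \<forall>h\<in>F. g \<otimes>\<^bsub>\<Gamma>\<^esub> h \<in> F \<longrightarrow> \<rho> (g \<otimes>\<^bsub>\<Gamma>\<^esub> h) = \<rho> g \<otimes>\<^bsub>Q\<^esub> \<rho> h) \<and>
        (\<forall>g\<in>F. \<forall>x\<in>Z. \<alpha> g x \<in> Z \<longrightarrow> \<pi> (\<alpha> g x) = \<beta> (\<rho> g) (\<pi> x))))"

end

theory Submission
  imports Defs
begin

text \<open>
  If the wreath product is approximated by a finite group \<open>Q\<close>, then \<open>Q\<close> acts by conjugation on its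
  own commutation graph, and sending a vertex \<open>v\<close> to the image of a fixed nontrivial element of
  \<open>H\<^sub>v\<close> approximates the action on \<open>X\<close>, because elements of nonadjacent vertex groups do not commute.

  Conversely, finite approximations of \<open>H\<close> and of the action give a finite group \<open>L\<close> and a finite
  group \<open>Q\<close> acting on a finite graph \<open>Y\<close>. The graph product of \<open>L\<close> over \<open>Y\<close> is infinite, but it acts on
  a finite set of heaps of bounded height, compatibly with \<open>Q\<close>, and short nonempty reduced words move
  the empty heap. An equality in the graph product over \<open>X\<close> involves finitely many letters only, so
  it survives in every approximation that is good enough, and reduced words remain reduced.
  A finite approximation of \<open>\<Gamma>\<close> is added as a direct factor to separate its elements.
\<close>

section \<open>Words in free products and graph products\<close>

text \<open>Renaming words over \<open>X\<close> to words over \<open>Y\<close> does not yet give a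
  finite target. What is missing is a finite quotient of the graph product of \<open>L\<close> over
  \<open>Y\<close> that is invariant under \<open>Q\<close> and still separates the given elements.
  Heaps supply it: a graph automorphism permutes the stacks and leaves heights alone, so
  \<open>Q\<close> and the graph product act on one finite set, and with them their semidirect
  product. Truncation respects the relations because the height that decides whether a letter at
  \<open>i\<close> is ignored is \<open>level i\<close>, which no letter at \<open>i\<close> or at a
  neighbour of \<open>i\<close> can change. The other obstacle is that a partial map respects
  products only inside a finite set, whereas an equality of classes is witnessed by a derivation
  through unknown intermediate words. Such an equality is therefore transferred to all
  approximations beyond some finite set of letters at once, in the language of the filter
  \<open>finite_subsets_at_top\<close>. A vertex of \<open>X\<close> is assumed, since without
  vertices the wreath product is a copy of \<open>\<Gamma>\<close> and carries no information on
  \<open>H\<close>.\<close>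

definition inv_word :: "('i \<Rightarrow> ('a, 'b) monoid_scheme) \<Rightarrow> ('i \<times> 'a) list \<Rightarrow> ('i \<times> 'a) list" where
  "inv_word G w = rev (map (\<lambda>(i, x). (i, inv\<^bsub>G i\<^esub> x)) w)"

lemma words_Nil [simp]: "[] \<in> words I G"
  and words_Cons [simp]: "a # w \<in> words I G \<longleftrightarrow> fst a \<in> I \<and> snd a \<in> carrier (G (fst a)) \<and> w \<in> words I G"
  and words_append [simp]: "u @ w \<in> words I G \<longleftrightarrow> u \<in> words I G \<and> w \<in> words I G"
  by (cases a; auto simp: words_def)+

lemma words_iff_set: "w \<in> words I (\<lambda>_. H) \<longleftrightarrow> set w \<subseteq> I \<times> carrier H"
  by (auto simp: words_def lists_eq_set)

locale group_family =
  fixes I :: "'i set" and G :: "'i \<Rightarrow> ('a, 'b) monoid_scheme"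
  assumes group: "i \<in> I \<Longrightarrow> group (G i)"
begin

abbreviation word_class :: "('i \<times> 'a) list \<Rightarrow> ('i \<times> 'a) list set" where
  "word_class w \<equiv> free_product_rel I G `` {w}"

lemma free_product_rel_words:
  assumes "(u, w) \<in> free_product_rel I G"
  shows "u \<in> words I G \<and> w \<in> words I G"
  using assms
  by induction (use group in \<open>auto intro: group.is_monoid monoid.one_closed monoid.m_closed\<close>)

lemma equiv_free_product_rel: "equiv (words I G) (free_product_rel I G)"
  by (rule equivI)
    (use free_product_rel_words free_product_rel.trans in
      \<open>auto simp: refl_on_def intro!: symI transI intro: free_product_rel.refl free_product_rel.sym\<close>)

lemma free_product_rel_context:
  assumes "(u, w) \<in> free_product_rel I G" and "a \<in> words I G" "b \<in> words I G"
  shows "(a @ u @ b, a @ w @ b) \<in> free_product_rel I G"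
  using assms(1)
proof induction
  case (one u w i)
  then show ?case
    using free_product_rel.one[of "a @ u" I G "w @ b" i] assms(2,3) by simp
next
  case (mult u w i x y)
  then show ?case
    using free_product_rel.mult[of "a @ u" I G "w @ b" i x y] assms(2,3) by simp
next
  case (refl w)
  then show ?case using assms(2,3) by (auto intro: free_product_rel.refl)
qed (blast intro: free_product_rel.sym free_product_rel.trans)+

lemma free_product_rel_append:
  assumes "(u, u') \<in> free_product_rel I G" and "(w, w') \<in> free_product_rel I G"
  shows "(u @ w, u' @ w') \<in> free_product_rel I G"
proof (rule free_product_rel.trans)
  show "(u @ w, u' @ w) \<in> free_product_rel I G"
    using free_product_rel_context[OF assms(1), of "[]" w] free_product_rel_words[OF assms(2)] by simp
  show "(u' @ w, u' @ w') \<in> free_product_rel I G"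
    using free_product_rel_context[OF assms(2), of u' "[]"] free_product_rel_words[OF assms(1)] by simp
qed

lemma word_class_eq_iff:
  assumes "u \<in> words I G" "w \<in> words I G"
  shows "word_class u = word_class w \<longleftrightarrow> (u, w) \<in> free_product_rel I G"
  using eq_equiv_class_iff[OF equiv_free_product_rel assms] .

lemma free_product_carrier: "carrier (free_product I G) = word_class ` words I G"
  by (auto simp: free_product_def quotient_def)

lemma free_product_one: "\<one>\<^bsub>free_product I G\<^esub> = word_class []"
  by (simp add: free_product_def)

lemma free_product_mult:
  assumes "u \<in> words I G" "w \<in> words I G"
  shows "word_class u \<otimes>\<^bsub>free_product I G\<^esub> word_class w = word_class (u @ w)"
proof -
  have "word_class u \<otimes>\<^bsub>free_product I G\<^esub> word_class w =
      free_product_rel I G `` {a @ b | a b. (u, a) \<in> free_product_rel I G \<and> (w, b) \<in> free_product_rel I G}"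
    by (simp add: free_product_def)
  also have "\<dots> = word_class (u @ w)"
  proof (intro equalityI subsetI)
    fix z assume "z \<in> free_product_rel I G `` {a @ b | a b. (u, a) \<in> free_product_rel I G \<and> (w, b) \<in> free_product_rel I G}"
    then show "z \<in> word_class (u @ w)"
      using free_product_rel_append free_product_rel.trans by blast
  next
    fix z assume "z \<in> word_class (u @ w)"
    then show "z \<in> free_product_rel I G `` {a @ b | a b. (u, a) \<in> free_product_rel I G \<and> (w, b) \<in> free_product_rel I G}"
      using assms free_product_rel.refl by blast
  qed
  finally show ?thesis .
qed

lemma inv_word_closed: "w \<in> words I G \<Longrightarrow> inv_word G w \<in> words I G"
  by (induction w) (use group in \<open>auto simp: inv_word_def\<close>)

lemma inv_word_cancel:
  "w \<in> words I G \<Longrightarrow> (inv_word G w @ w, []) \<in> free_product_rel I G"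
proof (induction w)
  case Nil
  then show ?case by (simp add: inv_word_def free_product_rel.refl)
next
  case (Cons a w)
  obtain i x where a: "a = (i, x)" by force
  with Cons have i: "i \<in> I" and x: "x \<in> carrier (G i)" and w: "w \<in> words I G" by auto
  interpret Gi: group "G i" by (rule group[OF i])
  have v: "inv_word G w \<in> words I G" using w by (rule inv_word_closed)
  have "(inv_word G w @ [(i, inv\<^bsub>G i\<^esub> x), (i, x)] @ w,
      inv_word G w @ [(i, inv\<^bsub>G i\<^esub> x \<otimes>\<^bsub>G i\<^esub> x)] @ w) \<in> free_product_rel I G"
    using v w i x by (intro free_product_rel.mult) auto
  moreover have "(inv_word G w @ [(i, \<one>\<^bsub>G i\<^esub>)] @ w, inv_word G w @ w) \<in> free_product_rel I G"
    using v w i by (intro free_product_rel.one) auto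
  ultimately have "(inv_word G w @ [(i, inv\<^bsub>G i\<^esub> x), (i, x)] @ w, []) \<in> free_product_rel I G"
    using Cons.IH[OF w] x by (metis Gi.l_inv free_product_rel.trans)
  then show ?case by (simp add: a inv_word_def)
qed

lemma free_product_group: "group (free_product I G)"
proof (rule groupI)
  fix x assume "x \<in> carrier (free_product I G)"
  then obtain w where w: "w \<in> words I G" "x = word_class w"
    by (auto simp: free_product_carrier)
  then have "word_class (inv_word G w) \<otimes>\<^bsub>free_product I G\<^esub> x = \<one>\<^bsub>free_product I G\<^esub>"
    by (simp add: free_product_mult free_product_one inv_word_closed word_class_eq_iff inv_word_cancel)
  then show "\<exists>y\<in>carrier (free_product I G). y \<otimes>\<^bsub>free_product I G\<^esub> x = \<one>\<^bsub>free_product I G\<^esub>"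
    using w by (auto simp: free_product_carrier inv_word_closed)
qed (auto simp: free_product_carrier free_product_mult free_product_one)

lemma free_product_inv:
  assumes "w \<in> words I G"
  shows "inv\<^bsub>free_product I G\<^esub> (word_class w) = word_class (inv_word G w)"
proof -
  interpret P: group "free_product I G" by (rule free_product_group)
  show ?thesis
    using assms
    by (intro P.inv_equality)
      (auto simp: free_product_carrier free_product_mult free_product_one inv_word_closed
        word_class_eq_iff inv_word_cancel)
qed

end

section \<open>Graph products as words modulo an explicit relation\<close>

text \<open>The clauses of the free product relation with one more for adjacent vertices. It
  replaces the quotient by a normal closure, so that equality in the graph product can be treated by
  rule induction; \<open>gp_class_eq_iff\<close> shows that both quotients agree.\<close>

inductive_set graph_product_rel ::
  "('h, 'b) monoid_scheme \<Rightarrow> 'v pair_pre_digraph \<Rightarrow> (('v \<times> 'h) list \<times> ('v \<times> 'h) list) set"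
  for H :: "('h, 'b) monoid_scheme" and X :: "'v pair_pre_digraph" where
  refl: "w \<in> words (pverts X) (\<lambda>_. H) \<Longrightarrow> (w, w) \<in> graph_product_rel H X"
| sym: "(u, w) \<in> graph_product_rel H X \<Longrightarrow> (w, u) \<in> graph_product_rel H X"
| trans: "(u, v) \<in> graph_product_rel H X \<Longrightarrow> (v, w) \<in> graph_product_rel H X \<Longrightarrow>
    (u, w) \<in> graph_product_rel H X"
| one: "u \<in> words (pverts X) (\<lambda>_. H) \<Longrightarrow> w \<in> words (pverts X) (\<lambda>_. H) \<Longrightarrow> i \<in> pverts X \<Longrightarrow>
    (u @ [(i, \<one>\<^bsub>H\<^esub>)] @ w, u @ w) \<in> graph_product_rel H X"
| mult: "u \<in> words (pverts X) (\<lambda>_. H) \<Longrightarrow> w \<in> words (pverts X) (\<lambda>_. H) \<Longrightarrow> i \<in> pverts X \<Longrightarrow>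
    x \<in> carrier H \<Longrightarrow> y \<in> carrier H \<Longrightarrow>
    (u @ [(i, x), (i, y)] @ w, u @ [(i, x \<otimes>\<^bsub>H\<^esub> y)] @ w) \<in> graph_product_rel H X"
| comm: "u \<in> words (pverts X) (\<lambda>_. H) \<Longrightarrow> w \<in> words (pverts X) (\<lambda>_. H) \<Longrightarrow> (i, j) \<in> parcs X \<Longrightarrow>
    x \<in> carrier H \<Longrightarrow> y \<in> carrier H \<Longrightarrow>
    (u @ [(i, x), (j, y)] @ w, u @ [(j, y), (i, x)] @ w) \<in> graph_product_rel H X"

locale group_graph = H: group H + X: pair_bidirected_digraph X
  for H :: "('h, 'b) monoid_scheme" and X :: "'v pair_pre_digraph"
begin

sublocale group_family "pverts X" "\<lambda>_. H"
  by unfold_locales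

abbreviation "W \<equiv> words (pverts X) (\<lambda>_. H)"
abbreviation "P \<equiv> free_product (pverts X) (\<lambda>_. H)"
abbreviation "N \<equiv> normal_closure P (edge_commutators H X)"

sublocale P: group P
  by (rule free_product_group)

lemma arcs_verts: "(i, j) \<in> parcs X \<Longrightarrow> i \<in> pverts X \<and> j \<in> pverts X"
  by (auto dest: X.in_arcsD1 X.in_arcsD2)

lemma arcs_sym: "(i, j) \<in> parcs X \<Longrightarrow> (j, i) \<in> parcs X"
  using X.pair_sym_arcs by (auto simp: symmetric_def sym_def)

lemma arcs_irrefl: "(i, i) \<notin> parcs X"
  using X.pair_no_loops by force

lemma graph_product_rel_words:
  assumes "(u, w) \<in> graph_product_rel H X"
  shows "u \<in> W \<and> w \<in> W"
  using assms by induction (auto dest: arcs_verts)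

lemma free_product_rel_imp_graph_product_rel:
  assumes "(u, w) \<in> free_product_rel (pverts X) (\<lambda>_. H)"
  shows "(u, w) \<in> graph_product_rel H X"
  using assms 
proof induction
  case (sym u w)
  show ?case by (rule graph_product_rel.sym[OF sym.IH])
next
  case (trans u v w)
  then show ?case by (blast intro: graph_product_rel.trans)
qed (auto intro: graph_product_rel.refl graph_product_rel.one[simplified] graph_product_rel.mult[simplified])

lemma graph_product_rel_context:
  assumes "(u, w) \<in> graph_product_rel H X" and "a \<in> W" "b \<in> W"
  shows "(a @ u @ b, a @ w @ b) \<in> graph_product_rel H X"
  using assms(1)
proof induction
  case (one u w i)
  then show ?case
    using graph_product_rel.one[of "a @ u" X H "w @ b" i] assms(2,3) by simp
next
  case (mult u w i x y)
  then show ?case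
    using graph_product_rel.mult[of "a @ u" X H "w @ b" i x y] assms(2,3) by simp
next
  case (comm u w i j x y)
  then show ?case
    using graph_product_rel.comm[of "a @ u" X H "w @ b" i j x y] assms(2,3) by simp
next
  case (refl w)
  then show ?case using assms(2,3) by (auto intro: graph_product_rel.refl)
qed (blast intro: graph_product_rel.sym graph_product_rel.trans)+

lemma graph_product_rel_append:
  assumes "(u, u') \<in> graph_product_rel H X" and "(w, w') \<in> graph_product_rel H X"
  shows "(u @ w, u' @ w') \<in> graph_product_rel H X"
proof (rule graph_product_rel.trans)
  show "(u @ w, u' @ w) \<in> graph_product_rel H X"
    using graph_product_rel_context[OF assms(1), of "[]" w] graph_product_rel_words[OF assms(2)] by simp
  show "(u' @ w, u' @ w') \<in> graph_product_rel H X"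
    using graph_product_rel_context[OF assms(2), of u' "[]"] graph_product_rel_words[OF assms(1)] by simp
qed

lemma edge_commutators_eq:
  "edge_commutators H X = {word_class [(i, inv\<^bsub>H\<^esub> x), (j, inv\<^bsub>H\<^esub> y), (i, x), (j, y)] | i j x y.
    (i, j) \<in> parcs X \<and> x \<in> carrier H \<and> y \<in> carrier H}"
proof -
  have "inv\<^bsub>P\<^esub> (word_class [(i, x)]) \<otimes>\<^bsub>P\<^esub> inv\<^bsub>P\<^esub> (word_class [(j, y)]) \<otimes>\<^bsub>P\<^esub> word_class [(i, x)]
      \<otimes>\<^bsub>P\<^esub> word_class [(j, y)] = word_class [(i, inv\<^bsub>H\<^esub> x), (j, inv\<^bsub>H\<^esub> y), (i, x), (j, y)]"
    if "(i, j) \<in> parcs X" "x \<in> carrier H" "y \<in> carrier H" for i j x y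
    using that arcs_verts[OF that(1)]
    by (simp add: free_product_inv free_product_mult inv_word_def)
  then show ?thesis
    unfolding edge_commutators_def Let_def free_product_incl_def
    by (intro Collect_cong) metis
qed

lemma edge_commutators_closed: "edge_commutators H X \<subseteq> carrier P"
  by (auto simp: edge_commutators_eq free_product_carrier dest: arcs_verts intro!: imageI)

lemma normal_normal_closure: "N \<lhd> P"
  unfolding normal_closure_def
proof (rule P.normal_generateI)
  fix h g
  assume g: "g \<in> carrier P"
    and "h \<in> {x \<otimes>\<^bsub>P\<^esub> s \<otimes>\<^bsub>P\<^esub> inv\<^bsub>P\<^esub> x |x s. x \<in> carrier P \<and> s \<in> edge_commutators H X}"
  then obtain x s where h: "h = x \<otimes>\<^bsub>P\<^esub> s \<otimes>\<^bsub>P\<^esub> inv\<^bsub>P\<^esub> x" "x \<in> carrier P" "s \<in> edge_commutators H X"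
    by blast
  then have "s \<in> carrier P" using edge_commutators_closed by blast
  with g h have "g \<otimes>\<^bsub>P\<^esub> h \<otimes>\<^bsub>P\<^esub> inv\<^bsub>P\<^esub> g = (g \<otimes>\<^bsub>P\<^esub> x) \<otimes>\<^bsub>P\<^esub> s \<otimes>\<^bsub>P\<^esub> inv\<^bsub>P\<^esub> (g \<otimes>\<^bsub>P\<^esub> x)"
    by (simp add: P.inv_mult_group P.m_assoc)
  then show "g \<otimes>\<^bsub>P\<^esub> h \<otimes>\<^bsub>P\<^esub> inv\<^bsub>P\<^esub> g \<in>
      {x \<otimes>\<^bsub>P\<^esub> s \<otimes>\<^bsub>P\<^esub> inv\<^bsub>P\<^esub> x |x s. x \<in> carrier P \<and> s \<in> edge_commutators H X}"
    using g h by blast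
qed (use edge_commutators_closed in auto)

sublocale N: normal N P
  by (rule normal_normal_closure)

lemma edge_commutators_subset: "edge_commutators H X \<subseteq> N"
proof
  fix s assume s: "s \<in> edge_commutators H X"
  then have "s = \<one>\<^bsub>P\<^esub> \<otimes>\<^bsub>P\<^esub> s \<otimes>\<^bsub>P\<^esub> inv\<^bsub>P\<^esub> \<one>\<^bsub>P\<^esub>"
    using edge_commutators_closed by auto
  then show "s \<in> N"
    unfolding normal_closure_def using s by (intro generate.incl) blast
qed

lemma edge_commutator_rel:
  assumes e: "(i, j) \<in> parcs X" and "x \<in> carrier H" "y \<in> carrier H"
  shows "([(i, inv\<^bsub>H\<^esub> x), (j, inv\<^bsub>H\<^esub> y), (i, x), (j, y)], []) \<in> graph_product_rel H X"
proof -
  let ?w = "[(j, y), (i, x)]"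
  have "([(i, inv\<^bsub>H\<^esub> x), (j, inv\<^bsub>H\<^esub> y), (i, x), (j, y)], [(i, inv\<^bsub>H\<^esub> x), (j, inv\<^bsub>H\<^esub> y), (j, y), (i, x)])
      \<in> graph_product_rel H X"
    using graph_product_rel.comm[of "[(i, inv\<^bsub>H\<^esub> x), (j, inv\<^bsub>H\<^esub> y)]" X H "[]" i j x y] assms arcs_verts[OF e]
    by simp
  also have "([(i, inv\<^bsub>H\<^esub> x), (j, inv\<^bsub>H\<^esub> y), (j, y), (i, x)], []) \<in> graph_product_rel H X"
    using inv_word_cancel[of ?w] assms arcs_verts[OF e]
    by (simp add: inv_word_def free_product_rel_imp_graph_product_rel)
  finally (graph_product_rel.trans) show ?thesis .
qed

text \<open>A normal closure is the smallest subgroup containing the conjugates, so it is enough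
  that the words related to \<open>[]\<close> form a subgroup containing every conjugated
  commutator. This half of the comparison shows that the explicit relation is large enough.\<close>

lemma normal_closure_rel:
  "N \<subseteq> {word_class w | w. (w, []) \<in> graph_product_rel H X}" (is "_ \<subseteq> ?M")
  unfolding normal_closure_def
proof (rule P.generate_subgroup_incl)
  show "subgroup ?M P"
  proof (rule P.subgroupI)
    show "?M \<subseteq> carrier P"
      by (auto simp: free_product_carrier dest: graph_product_rel_words)
    show "?M \<noteq> {}"
      using graph_product_rel.refl[of "[]" X H] by auto
  next
    fix A assume "A \<in> ?M"
    then obtain w where A: "A = word_class w" and w: "(w, []) \<in> graph_product_rel H X"
      by auto
    have W: "w \<in> W" using graph_product_rel_words[OF w] by simp
    have "(inv_word (\<lambda>_. H) w @ w, inv_word (\<lambda>_. H) w) \<in> graph_product_rel H X"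
      using graph_product_rel_context[OF w, of "inv_word (\<lambda>_. H) w" "[]"] W inv_word_closed by simp
    then have "(inv_word (\<lambda>_. H) w, []) \<in> graph_product_rel H X"
      using free_product_rel_imp_graph_product_rel[OF inv_word_cancel[OF W]]
      by (blast intro: graph_product_rel.sym graph_product_rel.trans)
    then show "inv\<^bsub>P\<^esub> A \<in> ?M"
      using W A free_product_inv by auto
  next
    fix A B assume "A \<in> ?M" "B \<in> ?M"
    then obtain u w where "A = word_class u" "(u, []) \<in> graph_product_rel H X"
      "B = word_class w" "(w, []) \<in> graph_product_rel H X"
      by auto
    moreover from this have "u \<in> W" "w \<in> W"
      using graph_product_rel_words by blast+
    ultimately show "A \<otimes>\<^bsub>P\<^esub> B \<in> ?M"
      using graph_product_rel_append[of u "[]" w "[]"] by (auto simp: free_product_mult)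
  qed
next
  show "{x \<otimes>\<^bsub>P\<^esub> s \<otimes>\<^bsub>P\<^esub> inv\<^bsub>P\<^esub> x |x s. x \<in> carrier P \<and> s \<in> edge_commutators H X} \<subseteq> ?M"
  proof clarify
    fix A s assume "A \<in> carrier P" "s \<in> edge_commutators H X"
    then obtain a i j x y where a: "a \<in> W" "A = word_class a"
      and e: "(i, j) \<in> parcs X" "x \<in> carrier H" "y \<in> carrier H"
      and s_eq: "s = word_class [(i, inv\<^bsub>H\<^esub> x), (j, inv\<^bsub>H\<^esub> y), (i, x), (j, y)]"
      by (auto simp: edge_commutators_eq free_product_carrier)
    let ?s = "[(i, inv\<^bsub>H\<^esub> x), (j, inv\<^bsub>H\<^esub> y), (i, x), (j, y)]"
    let ?b = "inv_word (\<lambda>_. H) a"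
    have s: "?s \<in> W" using e arcs_verts[OF e(1)] by auto
    have b: "?b \<in> W" using a by (simp add: inv_word_closed)
    have "(a @ ?s @ ?b, a @ [] @ ?b) \<in> graph_product_rel H X"
      using e a b by (intro graph_product_rel_context edge_commutator_rel)
    moreover have "word_class (a @ ?b) = word_class []"
      using a b P.r_inv[of "word_class a"]
      by (simp add: free_product_inv free_product_mult free_product_one free_product_carrier)
    then have "(a @ [] @ ?b, []) \<in> graph_product_rel H X"
      using a b by (simp add: word_class_eq_iff free_product_rel_imp_graph_product_rel)
    moreover have "A \<otimes>\<^bsub>P\<^esub> s \<otimes>\<^bsub>P\<^esub> inv\<^bsub>P\<^esub> A = word_class (a @ ?s @ ?b)"
      using a b s by (simp add: s_eq free_product_inv free_product_mult del: words_Cons)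
    ultimately show "\<exists>w. A \<otimes>\<^bsub>P\<^esub> s \<otimes>\<^bsub>P\<^esub> inv\<^bsub>P\<^esub> A = word_class w \<and> (w, []) \<in> graph_product_rel H X"
      by (blast intro: graph_product_rel.trans)
  qed
qed

definition gp_class :: "('v \<times> 'h) list \<Rightarrow> ('v \<times> 'h) list set set" where
  "gp_class w = N #>\<^bsub>P\<^esub> word_class w"

lemma word_class_closed [simp]: "w \<in> W \<Longrightarrow> word_class w \<in> carrier P"
  by (simp add: free_product_carrier)

lemma graph_product_carrier: "carrier (graph_product H X) = gp_class ` W"
  by (auto simp: graph_product_def Let_def FactGroup_def RCOSETS_def free_product_carrier gp_class_def)

lemma graph_product_mult:
  "u \<in> W \<Longrightarrow> w \<in> W \<Longrightarrow> gp_class u \<otimes>\<^bsub>graph_product H X\<^esub> gp_class w = gp_class (u @ w)"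
  by (simp add: graph_product_def Let_def FactGroup_def gp_class_def N.rcos_sum free_product_mult)

lemma graph_product_one: "\<one>\<^bsub>graph_product H X\<^esub> = gp_class []"
  by (simp add: graph_product_def Let_def FactGroup_def gp_class_def P.coset_mult_one[OF N.subset] flip: free_product_one)

lemma gp_class_swap:
  assumes e: "(i, j) \<in> parcs X" "x \<in> carrier H" "y \<in> carrier H"
  shows "gp_class [(i, x), (j, y)] = gp_class [(j, y), (i, x)]"
proof -
  \<comment> \<open>Relators have the form \<open>h^-1 k^-1 h k\<close>. Taken at the inverses of
    \<open>x\<close> and \<open>y\<close> this is \<open>?s\<close>, and \<open>?s @ ?w\<close>
    cancels to the word on the left.\<close>
  let ?s = "[(i, x), (j, y), (i, inv\<^bsub>H\<^esub> x), (j, inv\<^bsub>H\<^esub> y)]" and ?w = "[(j, y), (i, x)]"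
  have "word_class ?s \<in> edge_commutators H X"
    unfolding edge_commutators_eq using e
    by (intro CollectI exI[of _ i] exI[of _ j] exI[of _ "inv\<^bsub>H\<^esub> x"] exI[of _ "inv\<^bsub>H\<^esub> y"]) simp
  then have s: "word_class ?s \<in> N" using edge_commutators_subset by blast
  have W: "?w \<in> W" "?s \<in> W" "[(i, x), (j, y)] \<in> W"
    using e arcs_verts[OF e(1)] by auto
  have "([(i, x), (j, y)] @ inv_word (\<lambda>_. H) ?w @ ?w, [(i, x), (j, y)] @ []) \<in> free_product_rel (pverts X) (\<lambda>_. H)"
    using W by (intro free_product_rel_append inv_word_cancel free_product_rel.refl)
  then have "word_class (?s @ ?w) = word_class [(i, x), (j, y)]"
    using W by (subst word_class_eq_iff) (auto simp: inv_word_def)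
  then have "word_class [(i, x), (j, y)] = word_class ?s \<otimes>\<^bsub>P\<^esub> word_class ?w"
    using W by (simp add: free_product_mult del: words_Cons)
  then have "word_class [(i, x), (j, y)] \<in> N #>\<^bsub>P\<^esub> word_class ?w"
    using s by (auto simp: r_coset_def)
  then show ?thesis
    unfolding gp_class_def using W by (metis P.repr_independence N.subgroup_axioms word_class_closed)
qed

text \<open>From cosets to words, a factor in \<open>N\<close> is a word that can be erased by
  \<open>normal_closure_rel\<close>. From words to cosets, each clause of the relation is checked,
  with \<open>gp_class_swap\<close> for \<open>comm\<close>.\<close>

lemma gp_class_eq_iff:
  assumes "u \<in> W" "w \<in> W"
  shows "gp_class u = gp_class w \<longleftrightarrow> (u, w) \<in> graph_product_rel H X"
proof
  assume "gp_class u = gp_class w"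
  then have "word_class u \<in> N #>\<^bsub>P\<^esub> word_class w"
    unfolding gp_class_def using assms(1) P.rcos_self[OF word_class_closed N.subgroup_axioms] by blast
  then obtain A where A: "A \<in> N" "word_class u = A \<otimes>\<^bsub>P\<^esub> word_class w"
    by (auto simp: r_coset_def)
  then obtain n where n: "A = word_class n" "(n, []) \<in> graph_product_rel H X"
    using normal_closure_rel by blast
  have "n \<in> W" using n graph_product_rel_words by blast
  then have "(u, n @ w) \<in> free_product_rel (pverts X) (\<lambda>_. H)"
    using A n assms by (simp add: free_product_mult word_class_eq_iff)
  moreover have "(n @ w, w) \<in> graph_product_rel H X"
    using graph_product_rel_append[OF n(2) graph_product_rel.refl[OF assms(2)]] by simp
  ultimately show "(u, w) \<in> graph_product_rel H X"
    by (blast intro: free_product_rel_imp_graph_product_rel graph_product_rel.trans)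
next
  assume "(u, w) \<in> graph_product_rel H X"
  then show "gp_class u = gp_class w"
  proof induction
    case (one u w i)
    then have "word_class (u @ [(i, \<one>\<^bsub>H\<^esub>)] @ w) = word_class (u @ w)"
      using free_product_rel.one[of u _ "\<lambda>_. H" w i] by (subst word_class_eq_iff) auto
    then show ?case by (simp add: gp_class_def)
  next
    case (mult u w i x y)
    then have "word_class (u @ [(i, x), (i, y)] @ w) = word_class (u @ [(i, x \<otimes>\<^bsub>H\<^esub> y)] @ w)"
      using free_product_rel.mult[of u _ "\<lambda>_. H" w i x y] by (subst word_class_eq_iff) auto
    then show ?case by (simp add: gp_class_def)
  next
    case (comm u w i j x y)
    have "[(i, x), (j, y)] \<in> W" "[(j, y), (i, x)] \<in> W"
      using comm arcs_verts[OF comm(3)] by auto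
    with comm gp_class_swap[of i j x y] show ?case
      by (simp del: words_Cons append_Cons append_Nil flip: graph_product_mult)
  qed auto
qed

text \<open>\<open>induced_action\<close> treats a coset as a bare set of sets of words. This
  description by representatives makes its effect computable.\<close>

lemma gp_class_conv:
  assumes "w \<in> W"
  shows "gp_class w = word_class ` {u. (u, w) \<in> graph_product_rel H X}"
proof -
  have mem_iff: "word_class u \<in> gp_class w \<longleftrightarrow> (u, w) \<in> graph_product_rel H X" if u: "u \<in> W" for u
  proof -
    have "word_class u \<in> gp_class w \<longleftrightarrow> gp_class u = gp_class w"
      using P.rcos_self[OF word_class_closed[OF u] N.subgroup_axioms]
        P.repr_independence[OF _ word_class_closed[OF assms] N.subgroup_axioms, of "word_class u"]
      unfolding gp_class_def by metis
    then show ?thesis using gp_class_eq_iff[OF u assms] by simp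
  qed
  show ?thesis
  proof (rule equalityI; rule subsetI)
    fix A assume A: "A \<in> gp_class w"
    then have "A \<in> carrier P"
      unfolding gp_class_def by (rule subsetD[OF P.r_coset_subset_G[OF N.subset word_class_closed[OF assms]]])
    then obtain u where "u \<in> W" "A = word_class u"
      unfolding free_product_carrier by (rule imageE)
    with A mem_iff show "A \<in> word_class ` {u. (u, w) \<in> graph_product_rel H X}"
      by simp
  next
    fix A assume "A \<in> word_class ` {u. (u, w) \<in> graph_product_rel H X}"
    then show "A \<in> gp_class w"
      using mem_iff graph_product_rel_words by (elim imageE) simp
  qed
qed

end

section \<open>Partial embeddings on a set of letters\<close>

text \<open>The approximation of \<open>H\<close> and that of the graph are joined into one
  condition on a set \<open>B\<close> of letters. Only the projections of \<open>B\<close> matter: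
  \<open>\<pi>\<close> is controlled on its vertices and \<open>\<psi>\<close> on its group
  elements; elsewhere both are arbitrary.\<close>

definition local_embedding ::
  "('h, 'b) monoid_scheme \<Rightarrow> 'v pair_pre_digraph \<Rightarrow> ('v \<times> 'h) set \<Rightarrow>
    ('l, 'c) monoid_scheme \<Rightarrow> 'y pair_pre_digraph \<Rightarrow> ('v \<Rightarrow> 'y) \<Rightarrow> ('h \<Rightarrow> 'l) \<Rightarrow> bool" where
  "local_embedding H X B L Y \<pi> \<psi> \<longleftrightarrow>
    group_graph L Y \<and> \<pi> ` fst ` B \<subseteq> pverts Y \<and> \<psi> ` snd ` B \<subseteq> carrier L \<and>
    inj_on \<pi> (fst ` B) \<and> inj_on \<psi> (snd ` B) \<and>
    (\<forall>v\<in>fst ` B. \<forall>w\<in>fst ` B. (\<pi> v, \<pi> w) \<in> parcs Y \<longleftrightarrow> (v, w) \<in> parcs X) \<and>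
    (\<forall>x\<in>snd ` B. \<forall>y\<in>snd ` B. x \<otimes>\<^bsub>H\<^esub> y \<in> snd ` B \<longrightarrow> \<psi> (x \<otimes>\<^bsub>H\<^esub> y) = \<psi> x \<otimes>\<^bsub>L\<^esub> \<psi> y)"

lemma local_embeddingD:
  assumes "local_embedding H X B L Y \<pi> \<psi>"
  shows "group_graph L Y" and "inj_on \<pi> (fst ` B)" and "inj_on \<psi> (snd ` B)"
    and "\<And>v. v \<in> fst ` B \<Longrightarrow> \<pi> v \<in> pverts Y" and "\<And>x. x \<in> snd ` B \<Longrightarrow> \<psi> x \<in> carrier L"
    and "\<And>v w. v \<in> fst ` B \<Longrightarrow> w \<in> fst ` B \<Longrightarrow> (\<pi> v, \<pi> w) \<in> parcs Y \<longleftrightarrow> (v, w) \<in> parcs X"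
    and "\<And>x y. x \<in> snd ` B \<Longrightarrow> y \<in> snd ` B \<Longrightarrow> x \<otimes>\<^bsub>H\<^esub> y \<in> snd ` B \<Longrightarrow>
      \<psi> (x \<otimes>\<^bsub>H\<^esub> y) = \<psi> x \<otimes>\<^bsub>L\<^esub> \<psi> y"
  using assms unfolding local_embedding_def by blast+

text \<open>The image of the identity is idempotent, and the only idempotent of a group is its
  identity.\<close>

lemma local_embedding_one:
  assumes "group H" and emb: "local_embedding H X B L Y \<pi> \<psi>" and one: "\<one>\<^bsub>H\<^esub> \<in> snd ` B"
  shows "\<psi> \<one>\<^bsub>H\<^esub> = \<one>\<^bsub>L\<^esub>"
proof -
  interpret H: group H by fact
  interpret Y: group_graph L Y by (rule local_embeddingD(1)[OF emb])
  have "\<psi> \<one>\<^bsub>H\<^esub> = \<psi> \<one>\<^bsub>H\<^esub> \<otimes>\<^bsub>L\<^esub> \<psi> \<one>\<^bsub>H\<^esub>"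
    using local_embeddingD(7)[OF emb one one] one by simp
  then show ?thesis
    using local_embeddingD(5)[OF emb one] by (metis Y.H.l_cancel_one)
qed

context group_graph
begin

section \<open>Heaps of pieces\<close>

text \<open>
  A state stacks group elements over the vertices: \<open>\<sigma> i k\<close> is the element over vertex \<open>i\<close> at height
  \<open>k\<close>, where the identity stands for an empty position. Multiplication by a letter at \<open>i\<close> takes place
  at the lowest height above all pieces over the vertices that do not commute with \<open>i\<close>. This height
  does not depend on the stack over \<open>i\<close> itself, nor on those over the neighbours of \<open>i\<close>; hence each
  vertex group acts, and adjacent ones commute. Heights \<open>\<ge> n\<close> are left alone, which keeps the set of
  states finite.
\<close>

definition dependent :: "'v \<Rightarrow> 'v set" where
  "dependent i = {j \<in> pverts X. j \<noteq> i \<and> (i, j) \<notin> parcs X}"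

definition level :: "'v \<Rightarrow> ('v \<Rightarrow> nat \<Rightarrow> 'h) \<Rightarrow> nat" where
  "level i \<sigma> = (LEAST l. \<forall>j\<in>dependent i. \<forall>k\<ge>l. \<sigma> j k = \<one>\<^bsub>H\<^esub>)"

definition act :: "nat \<Rightarrow> 'v \<Rightarrow> 'h \<Rightarrow> ('v \<Rightarrow> nat \<Rightarrow> 'h) \<Rightarrow> 'v \<Rightarrow> nat \<Rightarrow> 'h" where
  "act n i x \<sigma> =
    (if level i \<sigma> < n \<and> \<sigma> i (level i \<sigma>) \<in> carrier H
     then \<sigma>(i := (\<sigma> i)(level i \<sigma> := x \<otimes>\<^bsub>H\<^esub> \<sigma> i (level i \<sigma>))) else \<sigma>)"

definition eval :: "nat \<Rightarrow> ('v \<times> 'h) list \<Rightarrow> ('v \<Rightarrow> nat \<Rightarrow> 'h) \<Rightarrow> 'v \<Rightarrow> nat \<Rightarrow> 'h" where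
  "eval n w = foldr (\<lambda>(i, x). act n i x) w"

definition base :: "'v \<Rightarrow> nat \<Rightarrow> 'h" where
  "base = (\<lambda>_ _. \<one>\<^bsub>H\<^esub>)"

lemma eval_Nil [simp]: "eval n [] \<sigma> = \<sigma>"
  and eval_Cons [simp]: "eval n ((i, x) # w) \<sigma> = act n i x (eval n w \<sigma>)"
  and eval_append [simp]: "eval n (u @ w) \<sigma> = eval n u (eval n w \<sigma>)"
  by (simp_all add: eval_def)

text \<open>The \<open>LEAST\<close> is taken of the same predicate on both sides, so this holds
  even for functions that admit no such height and leave \<open>level\<close> unspecified.\<close>

lemma level_update: "j \<notin> dependent i \<Longrightarrow> level i (\<sigma>(j := t)) = level i \<sigma>"
  unfolding level_def by (intro arg_cong[where f = Least] ext) (auto simp: fun_upd_def)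

lemma self_not_dependent: "i \<notin> dependent i"
  by (simp add: dependent_def)

lemma arc_not_dependent: "(i, j) \<in> parcs X \<Longrightarrow> j \<notin> dependent i"
  by (simp add: dependent_def)

text \<open>The carrier test in \<open>act\<close> makes this and \<open>act_mult\<close> true for
  arbitrary functions, not only for states. Evaluations of related words are therefore equal as
  functions.\<close>

lemma act_one: "act n i \<one>\<^bsub>H\<^esub> \<sigma> = \<sigma>"
  by (simp add: act_def)

lemma act_mult:
  assumes "x \<in> carrier H" "y \<in> carrier H"
  shows "act n i x (act n i y \<sigma>) = act n i (x \<otimes>\<^bsub>H\<^esub> y) \<sigma>"
  using assms by (simp add: act_def level_update self_not_dependent H.m_assoc)

lemma act_commute:
  assumes "(i, j) \<in> parcs X"
  shows "act n i x (act n j y \<sigma>) = act n j y (act n i x \<sigma>)"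
proof -
  have "i \<noteq> j" "i \<notin> dependent j" "j \<notin> dependent i"
    using assms arcs_irrefl arcs_sym arc_not_dependent by blast+
  then show ?thesis
    by (auto simp: act_def level_update fun_upd_twist)
qed

text \<open>Induction on the derivation: each use of \<open>one\<close>, \<open>mult\<close> or
  \<open>comm\<close> adds its own letters to the finite set that \<open>B\<close> has to contain,
  and \<open>trans\<close> takes a conjunction. The letters of the surrounding words may lie outside
  \<open>B\<close>: whatever they are renamed to, they act by the same function on both sides. The
  quantifiers over \<open>L\<close>, \<open>Y\<close> and \<open>n\<close> stand inside the filter
  because the approximation is chosen only after \<open>B\<close>.\<close>

lemma eventually_eval_eq:
  assumes "(u, w) \<in> graph_product_rel H X"
  shows "\<forall>\<^sub>F B in finite_subsets_at_top (pverts X \<times> carrier H).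
    \<forall>(L :: ('l, 'c) monoid_scheme) (Y :: 'y pair_pre_digraph) \<pi> \<psi> n. local_embedding H X B L Y \<pi> \<psi> \<longrightarrow>
      group_graph.eval L Y n (map (map_prod \<pi> \<psi>) u) = group_graph.eval L Y n (map (map_prod \<pi> \<psi>) w)"
  using assms
proof induction
  case (refl w)
  then show ?case by simp
next
  case (sym u w)
  then show ?case by (auto elim: eventually_mono)
next
  case (trans u v w)
  show ?case by (rule eventually_elim2[OF trans.IH]) metis
next
  case (one u w i)
  then have "\<forall>\<^sub>F B in finite_subsets_at_top (pverts X \<times> carrier H). {(i, \<one>\<^bsub>H\<^esub>)} \<subseteq> B"
    unfolding eventually_finite_subsets_at_top by (intro exI[of _ "{(i, \<one>\<^bsub>H\<^esub>)}"]) auto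
  then show ?case
  proof (rule eventually_mono, intro allI impI)
    fix B \<pi> \<psi> n and L :: "('l, 'c) monoid_scheme" and Y :: "'y pair_pre_digraph"
    assume B: "{(i, \<one>\<^bsub>H\<^esub>)} \<subseteq> B" and emb: "local_embedding H X B L Y \<pi> \<psi>"
    interpret Y: group_graph L Y by (rule local_embeddingD(1)[OF emb])
    have "\<one>\<^bsub>H\<^esub> \<in> snd ` B" using B by force
    then have "\<psi> \<one>\<^bsub>H\<^esub> = \<one>\<^bsub>L\<^esub>"
      using local_embedding_one[OF H.is_group emb] by blast
    then show "Y.eval n (map (map_prod \<pi> \<psi>) (u @ [(i, \<one>\<^bsub>H\<^esub>)] @ w)) =
        Y.eval n (map (map_prod \<pi> \<psi>) (u @ w))"
      by (intro ext) (simp add: Y.act_one)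
  qed
next
  case (mult u w i x y)
  let ?C = "{(i, x), (i, y), (i, x \<otimes>\<^bsub>H\<^esub> y)}"
  have "\<forall>\<^sub>F B in finite_subsets_at_top (pverts X \<times> carrier H). ?C \<subseteq> B"
    unfolding eventually_finite_subsets_at_top by (intro exI[of _ ?C]) (use mult in auto)
  then show ?case
  proof (rule eventually_mono, intro allI impI)
    fix B \<pi> \<psi> n and L :: "('l, 'c) monoid_scheme" and Y :: "'y pair_pre_digraph"
    assume B: "?C \<subseteq> B" and emb: "local_embedding H X B L Y \<pi> \<psi>"
    interpret Y: group_graph L Y by (rule local_embeddingD(1)[OF emb])
    have "x \<in> snd ` B" "y \<in> snd ` B" "x \<otimes>\<^bsub>H\<^esub> y \<in> snd ` B" using B by force+
    then have "\<psi> x \<in> carrier L" "\<psi> y \<in> carrier L" "\<psi> (x \<otimes>\<^bsub>H\<^esub> y) = \<psi> x \<otimes>\<^bsub>L\<^esub> \<psi> y"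
      using local_embeddingD(5,7)[OF emb] by blast+
    then show "Y.eval n (map (map_prod \<pi> \<psi>) (u @ [(i, x), (i, y)] @ w)) =
        Y.eval n (map (map_prod \<pi> \<psi>) (u @ [(i, x \<otimes>\<^bsub>H\<^esub> y)] @ w))"
      by (intro ext) (simp add: Y.act_mult)
  qed
next
  case (comm u w i j x y)
  let ?C = "{(i, x), (j, y)}"
  have "\<forall>\<^sub>F B in finite_subsets_at_top (pverts X \<times> carrier H). ?C \<subseteq> B"
    unfolding eventually_finite_subsets_at_top
    by (intro exI[of _ ?C]) (use comm arcs_verts in auto)
  then show ?case
  proof (rule eventually_mono, intro allI impI)
    fix B \<pi> \<psi> n and L :: "('l, 'c) monoid_scheme" and Y :: "'y pair_pre_digraph"
    assume B: "?C \<subseteq> B" and emb: "local_embedding H X B L Y \<pi> \<psi>"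
    interpret Y: group_graph L Y by (rule local_embeddingD(1)[OF emb])
    have "i \<in> fst ` B" "j \<in> fst ` B" using B by force+
    then have e: "(\<pi> i, \<pi> j) \<in> parcs Y"
      using local_embeddingD(6)[OF emb] comm.hyps by blast
    show "Y.eval n (map (map_prod \<pi> \<psi>) (u @ [(i, x), (j, y)] @ w)) =
        Y.eval n (map (map_prod \<pi> \<psi>) (u @ [(j, y), (i, x)] @ w))"
      by (intro ext) (simp add: Y.act_commute[OF e])
  qed
qed

text \<open>The identity is a local embedding for every \<open>B\<close>, so the statement for
  \<open>X\<close> itself is the case \<open>L = H\<close>, \<open>Y = X\<close> of the previous
  lemma.\<close>

lemma eval_cong:
  assumes "(u, w) \<in> graph_product_rel H X"
  shows "eval n u = eval n w"
proof -
  have "\<forall>\<^sub>F B in finite_subsets_at_top (pverts X \<times> carrier H). local_embedding H X B H X id id"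
    using group_graph_axioms
    by (intro eventually_finite_subsets_at_top_weakI) (auto simp: local_embedding_def)
  with eventually_eval_eq[OF assms, where 'l = 'h and 'c = 'b and 'y = 'v]
  have "\<forall>\<^sub>F B in finite_subsets_at_top (pverts X \<times> carrier H). eval n u = eval n w"
  proof eventually_elim
    case (elim B)
    then show ?case using elim(1)[rule_format, OF elim(2), of n] by (simp add: prod.map_id0)
  qed
  then show ?thesis by simp
qed

section \<open>Reduced words and the heaps they build\<close>

text \<open>Expresses that a letter at \<open>i\<close>, put in front of the word, can be moved past
  letters at neighbours of \<open>i\<close> until it meets another letter at
  \<open>i\<close>.\<close>

fun absorbs :: "'v \<Rightarrow> ('v \<times> 'h) list \<Rightarrow> bool" where
  "absorbs i [] = False"
| "absorbs i ((j, x) # w) = (j = i \<or> (i, j) \<in> parcs X \<and> absorbs i w)"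

text \<open>The usual reduced words of a graph product: no letter is trivial, and no two letters can
  be shuffled together and merged. Each letter is tested against the word to its right, which is the
  part that \<open>eval\<close> performs before it.\<close>

fun reduced :: "('v \<times> 'h) list \<Rightarrow> bool" where
  "reduced [] = True"
| "reduced ((i, x) # w) = (x \<noteq> \<one>\<^bsub>H\<^esub> \<and> \<not> absorbs i w \<and> reduced w)"

text \<open>The letter moves right past its neighbours and is merged with the letter at
  \<open>i\<close> that it meets, so the whole word loses one letter.\<close>

lemma absorbs_rel:
  assumes "w \<in> W" "i \<in> pverts X" "x \<in> carrier H" "absorbs i w"
  shows "\<exists>w'. ((i, x) # w, w') \<in> graph_product_rel H X \<and> length w' = length w"
  using assms
proof (induction w)
  case (Cons a w)
  obtain j y where a: "a = (j, y)" by force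
  have w: "w \<in> W" and y: "y \<in> carrier H" and j: "j \<in> pverts X" using Cons.prems a by auto
  show ?case
  proof (cases "j = i")
    case True
    have "((i, x) # a # w, (i, x \<otimes>\<^bsub>H\<^esub> y) # w) \<in> graph_product_rel H X"
      using graph_product_rel.mult[of "[]" X H w i x y] Cons.prems a True by simp
    then show ?thesis by (metis length_Cons)
  next
    case False
    then have e: "(i, j) \<in> parcs X" and ab: "absorbs i w" using Cons.prems a by auto
    obtain w' where w': "((i, x) # w, w') \<in> graph_product_rel H X" "length w' = length w"
      using Cons.IH[OF w Cons.prems(2,3) ab] by blast
    have "((i, x) # a # w, a # (i, x) # w) \<in> graph_product_rel H X"
      using graph_product_rel.comm[of "[]" X H w i j x y] Cons.prems a e by simp
    moreover have "(a # (i, x) # w, a # w') \<in> graph_product_rel H X"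
      using graph_product_rel_context[OF w'(1), of "[a]" "[]"] a y j by simp
    ultimately show ?thesis
      using w'(2) by (metis graph_product_rel.trans length_Cons)
  qed
qed simp

lemma not_reduced_shorter:
  assumes "w \<in> W" "\<not> reduced w"
  shows "\<exists>w'. (w, w') \<in> graph_product_rel H X \<and> length w' < length w"
  using assms
proof (induction w)
  case (Cons a w)
  obtain i x where a: "a = (i, x)" by force
  have w: "w \<in> W" and x: "x \<in> carrier H" and i: "i \<in> pverts X" using Cons.prems a by auto
  consider "x = \<one>\<^bsub>H\<^esub>" | "absorbs i w" | "\<not> reduced w" using Cons.prems a by auto
  then show ?case
  proof cases
    case 1
    then have "(a # w, w) \<in> graph_product_rel H X"
      using graph_product_rel.one[of "[]" X H w i] w i a by simp
    then show ?thesis by (metis length_Cons lessI)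
  next
    case 2
    then show ?thesis using absorbs_rel[OF w i x 2] a by (metis length_Cons lessI)
  next
    case 3
    obtain w' where w': "(w, w') \<in> graph_product_rel H X" "length w' < length w"
      using Cons.IH[OF w 3] by blast
    have "(a # w, a # w') \<in> graph_product_rel H X"
      using graph_product_rel_context[OF w'(1), of "[a]" "[]"] a x i by simp
    then show ?thesis using w'(2) by (metis length_Cons Suc_less_eq)
  qed
qed simp

lemma ex_reduced:
  assumes "w \<in> W"
  shows "\<exists>w'. (w, w') \<in> graph_product_rel H X \<and> reduced w'"
  using assms
proof (induction "length w" arbitrary: w rule: less_induct)
  case less
  show ?case
  proof (cases "reduced w")
    case True
    then show ?thesis using less.prems graph_product_rel.refl by blast
  next
    case False
    then obtain w' where w': "(w, w') \<in> graph_product_rel H X" "length w' < length w"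
      using not_reduced_shorter[OF less.prems] by blast
    then show ?thesis
      using less.hyps[OF w'(2)] graph_product_rel_words[OF w'(1)] graph_product_rel.trans by blast
  qed
qed

lemma level_le:
  assumes "\<And>j k. \<sigma> j k \<noteq> \<one>\<^bsub>H\<^esub> \<Longrightarrow> k < m"
  shows "level i \<sigma> \<le> m"
  unfolding level_def using assms by (intro Least_le) (meson leD)

text \<open>The bound \<open>m\<close> is a height satisfying the predicate, so \<open>level\<close>
  is a true minimum and not an unspecified number.\<close>

lemma above_level:
  assumes "\<And>j k. \<sigma> j k \<noteq> \<one>\<^bsub>H\<^esub> \<Longrightarrow> k < m" and "j \<in> dependent i" and "level i \<sigma> \<le> k"
  shows "\<sigma> j k = \<one>\<^bsub>H\<^esub>"
proof -
  have "\<forall>j\<in>dependent i. \<forall>k\<ge>m. \<sigma> j k = \<one>\<^bsub>H\<^esub>" using assms(1) by (meson leD)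
  then have "\<forall>j\<in>dependent i. \<forall>k\<ge>level i \<sigma>. \<sigma> j k = \<one>\<^bsub>H\<^esub>"
    unfolding level_def by (rule LeastI)
  then show ?thesis using assms(2,3) by blast
qed

lemma dependent_sym: "i \<in> pverts X \<Longrightarrow> j \<in> dependent i \<Longrightarrow> i \<in> dependent j"
  using arcs_sym by (auto simp: dependent_def)

text \<open>The third claim drives the induction: over a vertex that the word does not absorb, the
  position at its level is empty. Each letter of a reduced word thus adds a piece instead of
  multiplying into an old one. A letter raises the heap by at most one, so
  \<open>length w \<le> n\<close> keeps the truncation out of play.\<close>

lemma eval_reduced:
  assumes "reduced w" "w \<in> W" "length w \<le> n"
  defines "\<sigma> \<equiv> eval n w base"
  shows "\<sigma> j k \<in> carrier H" and "\<sigma> j k \<noteq> \<one>\<^bsub>H\<^esub> \<Longrightarrow> k < length w"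
    and "i \<in> pverts X \<Longrightarrow> \<not> absorbs i w \<Longrightarrow> \<sigma> i (level i \<sigma>) = \<one>\<^bsub>H\<^esub>"
proof -
  have "(\<forall>j k. \<sigma> j k \<in> carrier H) \<and> (\<forall>j k. \<sigma> j k \<noteq> \<one>\<^bsub>H\<^esub> \<longrightarrow> k < length w) \<and>
      (\<forall>i\<in>pverts X. \<not> absorbs i w \<longrightarrow> \<sigma> i (level i \<sigma>) = \<one>\<^bsub>H\<^esub>)"
    using assms unfolding \<sigma>_def
  proof (induction w)
    case Nil
    then show ?case by (simp add: base_def)
  next
    case (Cons a w)
    obtain j x where a: "a = (j, x)" by force
    let ?\<sigma> = "eval n w base"
    have x: "x \<in> carrier H" "x \<noteq> \<one>\<^bsub>H\<^esub>" and j: "j \<in> pverts X" and "\<not> absorbs j w" and len: "length w < n"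
      and IH: "\<And>j k. ?\<sigma> j k \<in> carrier H" "\<And>j k. ?\<sigma> j k \<noteq> \<one>\<^bsub>H\<^esub> \<Longrightarrow> k < length w"
        "\<And>i. i \<in> pverts X \<Longrightarrow> \<not> absorbs i w \<Longrightarrow> ?\<sigma> i (level i ?\<sigma>) = \<one>\<^bsub>H\<^esub>"
      using Cons a by auto
    have le: "level j ?\<sigma> \<le> length w" using IH(2) by (rule level_le)
    have free: "?\<sigma> j (level j ?\<sigma>) = \<one>\<^bsub>H\<^esub>" using IH(3) j \<open>\<not> absorbs j w\<close> by blast
    have push: "eval n (a # w) base = ?\<sigma>(j := (?\<sigma> j)(level j ?\<sigma> := x))" (is "_ = ?\<tau>")
      using le len free x by (simp add: a act_def)
    have bound: "k < Suc (length w)" if "?\<tau> i k \<noteq> \<one>\<^bsub>H\<^esub>" for i k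
      using that le IH(2)[of i k] by (auto split: if_splits)
    have "?\<tau> i (level i ?\<tau>) = \<one>\<^bsub>H\<^esub>" if i: "i \<in> pverts X" "\<not> absorbs i (a # w)" for i
    proof (cases "j \<in> dependent i")
      case True
      then have ij: "i \<in> dependent j" "i \<noteq> j" using dependent_sym[OF i(1)] by (auto simp: dependent_def)
      \<comment> \<open>The new piece over \<open>j\<close> blocks \<open>i\<close>, so
        \<open>i\<close> now acts above it; and since \<open>i\<close> blocks \<open>j\<close> as
        well, the stack over \<open>i\<close> is empty from height \<open>level j ?\<sigma>\<close>
        upwards.\<close>
      have "level j ?\<sigma> < level i ?\<tau>"
      proof (rule ccontr)
        assume "\<not> level j ?\<sigma> < level i ?\<tau>"
        then have "?\<tau> j (level j ?\<sigma>) = \<one>\<^bsub>H\<^esub>"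
          by (intro above_level[OF _ True, of ?\<tau> "Suc (length w)"]) (erule bound, simp)
        then show False using x by simp
      qed
      then have "?\<sigma> i (level i ?\<tau>) = \<one>\<^bsub>H\<^esub>"
        by (intro above_level[OF _ ij(1), of ?\<sigma> "length w"]) (erule IH(2), simp)
      then show ?thesis using ij(2) by simp
    next
      case False
      \<comment> \<open>Here \<open>j\<close> is \<open>i\<close> or a neighbour of
        \<open>i\<close>. The first is excluded because \<open>i\<close> would be absorbed at once;
        for a neighbour, neither the level of \<open>i\<close> nor its stack has changed.\<close>
      with i a j have "j \<noteq> i" "\<not> absorbs i w" by (auto simp: dependent_def)
      then show ?thesis using IH(3) i False by (simp add: level_update)
    qed
    then show ?case
      unfolding push using x IH(1) bound by auto
  qed
  then show "\<sigma> j k \<in> carrier H" and "\<sigma> j k \<noteq> \<one>\<^bsub>H\<^esub> \<Longrightarrow> k < length w"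
    and "i \<in> pverts X \<Longrightarrow> \<not> absorbs i w \<Longrightarrow> \<sigma> i (level i \<sigma>) = \<one>\<^bsub>H\<^esub>"
    by blast+
qed

text \<open>The leftmost letter acts last, on an empty position, and so remains visible
  there.\<close>

lemma eval_reduced_nontrivial:
  assumes "reduced w" "w \<in> W" "length w \<le> n" "w \<noteq> []"
  shows "eval n w base \<noteq> base"
proof -
  obtain i x v where w: "w = (i, x) # v" using assms(4) by (metis list.exhaust surj_pair)
  let ?\<sigma> = "eval n v base"
  have v: "reduced v" "v \<in> W" "length v \<le> n" "i \<in> pverts X" "\<not> absorbs i v" using assms w by auto
  note \<sigma> = eval_reduced[OF v(1-3)]
  have "level i ?\<sigma> \<le> length v" using \<sigma>(2) by (rule level_le)
  then have "eval n w base i (level i ?\<sigma>) = x \<otimes>\<^bsub>H\<^esub> \<one>\<^bsub>H\<^esub>"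
    using \<sigma>(1) \<sigma>(3)[OF v(4,5)] assms(3) by (simp add: w act_def)
  then have "eval n w base i (level i ?\<sigma>) \<noteq> \<one>\<^bsub>H\<^esub>" using assms w by simp
  then show ?thesis by (metis base_def)
qed

section \<open>The finite state space\<close>

definition states :: "nat \<Rightarrow> ('v \<Rightarrow> nat \<Rightarrow> 'h) set" where
  "states n = {\<sigma>. (\<forall>j k. \<sigma> j k \<in> carrier H) \<and> (\<forall>j k. j \<notin> pverts X \<or> n \<le> k \<longrightarrow> \<sigma> j k = \<one>\<^bsub>H\<^esub>)}"

lemma finite_states:
  assumes "finite (pverts X)" "finite (carrier H)"
  shows "finite (states n)"
proof -
  have "inj_on (\<lambda>\<sigma>. restrict (case_prod \<sigma>) (pverts X \<times> {..<n})) (states n)"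
  proof (rule inj_onI, intro ext)
    fix \<sigma> \<tau> j k
    assume s: "\<sigma> \<in> states n" "\<tau> \<in> states n"
      and eq: "restrict (case_prod \<sigma>) (pverts X \<times> {..<n}) = restrict (case_prod \<tau>) (pverts X \<times> {..<n})"
    show "\<sigma> j k = \<tau> j k"
    proof (cases "j \<in> pverts X \<and> k < n")
      case True
      then show ?thesis using fun_cong[OF eq, of "(j, k)"] by simp
    next
      case False
      then show ?thesis using s by (auto simp: states_def not_less)
    qed
  qed
  moreover have "(\<lambda>\<sigma>. restrict (case_prod \<sigma>) (pverts X \<times> {..<n})) ` states n
      \<subseteq> (pverts X \<times> {..<n}) \<rightarrow>\<^sub>E carrier H"
    by (intro image_subsetI) (simp add: restrict_PiE_iff states_def split: prod.split)
  moreover have "finite ((pverts X \<times> {..<n}) \<rightarrow>\<^sub>E carrier H)"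
    using assms by (intro finite_PiE) auto
  ultimately show ?thesis by (rule inj_on_finite)
qed

lemma base_states: "base \<in> states n"
  by (simp add: base_def states_def)

lemma act_states:
  "\<sigma> \<in> states n \<Longrightarrow> i \<in> pverts X \<Longrightarrow> x \<in> carrier H \<Longrightarrow> act n i x \<sigma> \<in> states n"
  by (auto simp: act_def states_def)

lemma bij_act:
  assumes "i \<in> pverts X" "x \<in> carrier H"
  shows "bij_betw (act n i x) (states n) (states n)"
  using assms by (intro bij_betw_byWitness[where f' = "act n i (inv\<^bsub>H\<^esub> x)"])
    (auto simp: act_mult act_one intro: act_states)

lemma bij_eval: "w \<in> W \<Longrightarrow> bij_betw (eval n w) (states n) (states n)"
proof (induction w)
  case Nil
  then show ?case by (simp add: bij_betw_def inj_on_def)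
next
  case (Cons a w)
  then have "bij_betw (act n (fst a) (snd a) \<circ> eval n w) (states n) (states n)"
    using bij_betw_trans[OF Cons.IH bij_act[of "fst a" "snd a"]] by simp
  moreover have "act n (fst a) (snd a) \<circ> eval n w = eval n (a # w)"
    by (cases a) auto
  ultimately show ?case by simp
qed

section \<open>Graph automorphisms acting on states\<close>

text \<open>The stack over \<open>j\<close> is moved to \<open>f j\<close>. As \<open>f\<close>
  permutes only the vertices, everything outside the vertex set stays in place; the composition law
  then holds for all functions, not only for states.\<close>

definition transport :: "('v \<Rightarrow> 'v) \<Rightarrow> ('v \<Rightarrow> nat \<Rightarrow> 'h) \<Rightarrow> 'v \<Rightarrow> nat \<Rightarrow> 'h" where
  "transport f \<sigma> j = (if j \<in> pverts X then \<sigma> (inv_into (pverts X) f j) else \<sigma> j)"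

lemma transport_apply:
  assumes "bij_betw f (pverts X) (pverts X)" "j \<in> pverts X"
  shows "transport f \<sigma> (f j) = \<sigma> j"
  using assms by (auto simp: transport_def bij_betw_def)

lemma transport_eqI:
  assumes "bij_betw f (pverts X) (pverts X)"
    and "\<And>j. j \<in> pverts X \<Longrightarrow> \<tau> (f j) = \<sigma> j" and "\<And>j. j \<notin> pverts X \<Longrightarrow> \<tau> j = \<sigma> j"
  shows "transport f \<sigma> = \<tau>"
proof
  fix j show "transport f \<sigma> j = \<tau> j"
  proof (cases "j \<in> pverts X")
    case True
    then obtain i where "i \<in> pverts X" "j = f i" using assms(1) by (auto simp: bij_betw_def)
    then show ?thesis using assms transport_apply by metis
  qed (use assms(3) in \<open>simp add: transport_def\<close>)
qed

lemma transport_comp: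
  assumes "bij_betw f (pverts X) (pverts X)" "bij_betw g (pverts X) (pverts X)"
    and "\<And>j. j \<in> pverts X \<Longrightarrow> h j = f (g j)"
  shows "transport h \<sigma> = transport f (transport g \<sigma>)"
proof (rule transport_eqI)
  have "bij_betw (f \<circ> g) (pverts X) (pverts X)" using assms(2,1) by (rule bij_betw_trans)
  then show "bij_betw h (pverts X) (pverts X)" using assms(3) by (simp cong: bij_betw_cong)
  fix j assume "j \<in> pverts X"
  then show "transport f (transport g \<sigma>) (h j) = \<sigma> j"
    using assms by (simp add: transport_apply bij_betw_apply)
qed (simp add: transport_def)

lemma transport_base: "transport f base = base"
  by (auto simp: transport_def base_def)

lemma transport_states:
  assumes "bij_betw f (pverts X) (pverts X)" "\<sigma> \<in> states n"
  shows "transport f \<sigma> \<in> states n"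
  using assms by (auto simp: states_def transport_def)

lemma bij_transport:
  assumes f: "bij_betw f (pverts X) (pverts X)"
  shows "bij_betw (transport f) (states n) (states n)"
proof -
  let ?g = "inv_into (pverts X) f"
  have g: "bij_betw ?g (pverts X) (pverts X)" using f by (rule bij_betw_inv_into)
  have id: "bij_betw id (pverts X) (pverts X)" by (rule bij_betw_id)
  have "transport id \<sigma> = \<sigma>" for \<sigma> by (rule transport_eqI[OF id]) auto
  moreover have "transport f (transport ?g \<sigma>) = transport id \<sigma>" for \<sigma>
    using f g by (intro transport_comp[symmetric]) (auto simp: bij_betw_inv_into_right)
  moreover have "transport ?g (transport f \<sigma>) = transport id \<sigma>" for \<sigma>
    using f g by (intro transport_comp[symmetric]) (auto simp: bij_betw_inv_into_left)
  ultimately show ?thesis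
    using transport_states[OF f] transport_states[OF g]
    by (intro bij_betw_byWitness[where f' = "transport ?g"]) auto
qed

lemma level_transport:
  assumes f: "bij_betw f (pverts X) (pverts X)"
    and arcs: "\<And>i j. i \<in> pverts X \<Longrightarrow> j \<in> pverts X \<Longrightarrow> (f i, f j) \<in> parcs X \<longleftrightarrow> (i, j) \<in> parcs X"
    and i: "i \<in> pverts X"
  shows "level (f i) (transport f \<sigma>) = level i \<sigma>"
proof -
  have "dependent (f i) = f ` dependent i"
  proof (intro equalityI subsetI)
    fix j assume j: "j \<in> dependent (f i)"
    then obtain k where "k \<in> pverts X" "j = f k"
      using f by (auto simp: bij_betw_def dependent_def)
    then show "j \<in> f ` dependent i" using j i arcs by (auto simp: dependent_def)
  next
    fix j assume "j \<in> f ` dependent i"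
    then show "j \<in> dependent (f i)"
      using f i arcs by (auto simp: dependent_def bij_betw_def inj_on_def)
  qed
  moreover have "transport f \<sigma> (f j) = \<sigma> j" if "j \<in> dependent i" for j
    using transport_apply[OF f] that by (simp add: dependent_def)
  ultimately show ?thesis by (simp add: level_def)
qed

text \<open>An automorphism maps the vertices dependent on \<open>i\<close> onto those dependent on
  \<open>f i\<close>, hence preserves levels. Conjugation by the transport along \<open>f\<close>
  thus turns the letter at \<open>i\<close> into the letter at \<open>f i\<close>, which is the
  defining relation of the semidirect product.\<close>

lemma act_transport:
  assumes f: "bij_betw f (pverts X) (pverts X)"
    and arcs: "\<And>i j. i \<in> pverts X \<Longrightarrow> j \<in> pverts X \<Longrightarrow> (f i, f j) \<in> parcs X \<longleftrightarrow> (i, j) \<in> parcs X"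
    and i: "i \<in> pverts X"
  shows "act n (f i) x (transport f \<sigma>) = transport f (act n i x \<sigma>)"
proof (rule transport_eqI[OF f, symmetric])
  fix j assume j: "j \<in> pverts X"
  have "f j = f i \<longleftrightarrow> j = i" using f i j by (auto simp: bij_betw_def inj_on_def)
  then show "act n (f i) x (transport f \<sigma>) (f j) = act n i x \<sigma> j"
    using level_transport[OF f arcs i] transport_apply[OF f i] transport_apply[OF f j]
    by (simp add: act_def)
next
  fix j assume "j \<notin> pverts X"
  moreover from this have "j \<noteq> i" "j \<noteq> f i" using i f by (auto simp: bij_betw_def)
  ultimately show "act n (f i) x (transport f \<sigma>) j = act n i x \<sigma> j"
    by (simp add: act_def transport_def)
qed

lemma eval_transport:
  assumes "bij_betw f (pverts X) (pverts X)"
    and "\<And>i j. i \<in> pverts X \<Longrightarrow> j \<in> pverts X \<Longrightarrow> (f i, f j) \<in> parcs X \<longleftrightarrow> (i, j) \<in> parcs X"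
    and "w \<in> W"
  shows "eval n (map (map_prod f id) w) (transport f \<sigma>) = transport f (eval n w \<sigma>)"
  using assms(3)
proof (induction w)
  case (Cons a w)
  then show ?case using act_transport[OF assms(1,2)] by (cases a) auto
qed simp

end

text \<open>An absorption in the image pulls back because \<open>\<pi>\<close> is injective and
  reflects adjacency; a trivial letter pulls back because \<open>\<psi>\<close> is injective and
  preserves the identity. This is where an induced subgraph is essential.\<close>

lemma local_embedding_reduced:
  assumes gr: "group_graph H X" and emb: "local_embedding H X B L Y \<pi> \<psi>"
    and one: "\<one>\<^bsub>H\<^esub> \<in> snd ` B" and "set w \<subseteq> B" "group_graph.reduced H X w"
  shows "group_graph.reduced L Y (map (map_prod \<pi> \<psi>) w)"
proof -
  interpret X: group_graph H X by fact
  interpret Y: group_graph L Y by (rule local_embeddingD(1)[OF emb])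
  have \<psi>1: "\<psi> \<one>\<^bsub>H\<^esub> = \<one>\<^bsub>L\<^esub>"
    using X.H.is_group emb one by (rule local_embedding_one)
  have absorbs: "X.absorbs i w" if "i \<in> fst ` B" "set w \<subseteq> B" "Y.absorbs (\<pi> i) (map (map_prod \<pi> \<psi>) w)" for i w
    using that(2,3)
  proof (induction w)
    case (Cons a w)
    obtain j x where a: "a = (j, x)" by force
    then have "j \<in> fst ` B" using Cons.prems(1) by force
    then have "\<pi> j = \<pi> i \<longleftrightarrow> j = i" "(\<pi> i, \<pi> j) \<in> parcs Y \<longleftrightarrow> (i, j) \<in> parcs X"
      using local_embeddingD(2,6)[OF emb] that(1) by (auto dest: inj_onD)
    then show ?case using Cons a by auto
  qed simp
  show ?thesis
    using assms(4,5)
  proof (induction w)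
    case (Cons a w)
    obtain i x where a: "a = (i, x)" by force
    then have ix: "i \<in> fst ` B" "x \<in> snd ` B" using Cons.prems(1) by force+
    then have "\<psi> x = \<one>\<^bsub>L\<^esub> \<longleftrightarrow> x = \<one>\<^bsub>H\<^esub>"
      using local_embeddingD(3)[OF emb] one by (metis \<psi>1 inj_onD)
    then show ?case using Cons a absorbs[OF ix(1), of w] by auto
  qed simp
qed

context group_graph
begin

section \<open>Graph wreath products\<close>

abbreviation relabel :: "('v \<Rightarrow> 'v) \<Rightarrow> ('v \<times> 'h) list \<Rightarrow> ('v \<times> 'h) list" where
  "relabel f \<equiv> map (map_prod f id)"

lemma relabel_closed: "f \<in> pverts X \<rightarrow> pverts X \<Longrightarrow> w \<in> W \<Longrightarrow> relabel f w \<in> W"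
  by (induction w) auto

lemma relabel_cong:
  assumes "w \<in> W" "\<And>v. v \<in> pverts X \<Longrightarrow> f (g v) = h v"
  shows "relabel f (relabel g w) = relabel h w"
  using assms by (induction w) auto

lemma relabel_ident:
  assumes "w \<in> W" "\<And>v. v \<in> pverts X \<Longrightarrow> f v = v"
  shows "relabel f w = w"
  using assms by (induction w) auto

lemma free_product_rel_relabel:
  assumes f: "f \<in> pverts X \<rightarrow> pverts X" and "(u, w) \<in> free_product_rel (pverts X) (\<lambda>_. H)"
  shows "(relabel f u, relabel f w) \<in> free_product_rel (pverts X) (\<lambda>_. H)"
  using assms(2)
proof induction
  case (refl w)
  then show ?case using f by (intro free_product_rel.refl relabel_closed)
next
  case (one u w i)
  then show ?case
    using free_product_rel.one[of "relabel f u" "pverts X" "\<lambda>_. H" "relabel f w" "f i"]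
      relabel_closed[OF f] f by (simp add: Pi_iff id_def)
next
  case (mult u w i x y)
  then show ?case
    using free_product_rel.mult[of "relabel f u" "pverts X" "\<lambda>_. H" "relabel f w" "f i" x y]
      relabel_closed[OF f] f by (simp add: Pi_iff id_def)
qed (blast intro: free_product_rel.sym free_product_rel.trans)+

lemma graph_product_rel_relabel:
  assumes f: "f \<in> pverts X \<rightarrow> pverts X"
    and arcs: "\<And>i j. (i, j) \<in> parcs X \<Longrightarrow> (f i, f j) \<in> parcs X"
    and "(u, w) \<in> graph_product_rel H X"
  shows "(relabel f u, relabel f w) \<in> graph_product_rel H X"
  using assms(3)
proof induction
  case (refl w)
  then show ?case using f by (intro graph_product_rel.refl relabel_closed)
next
  case (one u w i)
  then show ?case
    using graph_product_rel.one[of "relabel f u" X H "relabel f w" "f i"]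
      relabel_closed[OF f] f by (simp add: Pi_iff id_def)
next
  case (mult u w i x y)
  then show ?case
    using graph_product_rel.mult[of "relabel f u" X H "relabel f w" "f i" x y]
      relabel_closed[OF f] f by (simp add: Pi_iff id_def)
next
  case (comm u w i j x y)
  then show ?case
    using graph_product_rel.comm[of "relabel f u" X H "relabel f w" "f i" "f j" x y]
      relabel_closed[OF f] arcs by (simp add: id_def)
qed (blast intro: graph_product_rel.sym graph_product_rel.trans)+

lemma word_class_relabel:
  assumes f: "f \<in> pverts X \<rightarrow> pverts X" and g: "g \<in> pverts X \<rightarrow> pverts X"
    and inv: "\<And>v. v \<in> pverts X \<Longrightarrow> f (g v) = v" "\<And>v. v \<in> pverts X \<Longrightarrow> g (f v) = v"
    and u: "u \<in> W"
  shows "relabel f ` word_class u = word_class (relabel f u)"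
proof (intro equalityI subsetI)
  fix z assume "z \<in> relabel f ` word_class u"
  then show "z \<in> word_class (relabel f u)"
    using free_product_rel_relabel[OF f] by auto
next
  fix z assume z: "z \<in> word_class (relabel f u)"
  then have "z \<in> W" using free_product_rel_words by auto
  then have "z = relabel f (relabel g z)"
    using relabel_cong[of z f g id] relabel_ident[of z id] inv(1) by simp
  moreover have "relabel g (relabel f u) = u"
    using relabel_cong[of u g f id] relabel_ident[of u id] inv(2) u by simp
  then have "relabel g z \<in> word_class u"
    using free_product_rel_relabel[OF g, of "relabel f u" z] z by simp
  ultimately show "z \<in> relabel f ` word_class u" by (rule image_eqI)
qed

text \<open>Two layers of sets are relabelled, the coset and the classes inside it, and at each
  layer the image is at first only contained in the expected set. Relabelling back by the inverse
  \<open>g\<close> gives the other inclusion, so \<open>g\<close> must preserve arcs as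
  well.\<close>

lemma gp_class_relabel:
  assumes f: "f \<in> pverts X \<rightarrow> pverts X" and g: "g \<in> pverts X \<rightarrow> pverts X"
    and inv: "\<And>v. v \<in> pverts X \<Longrightarrow> f (g v) = v" "\<And>v. v \<in> pverts X \<Longrightarrow> g (f v) = v"
    and arcs: "\<And>i j. (i, j) \<in> parcs X \<Longrightarrow> (f i, f j) \<in> parcs X"
      "\<And>i j. (i, j) \<in> parcs X \<Longrightarrow> (g i, g j) \<in> parcs X"
    and w: "w \<in> W"
  shows "(\<lambda>A. relabel f ` A) ` gp_class w = gp_class (relabel f w)"
proof -
  have "(\<lambda>A. relabel f ` A) ` gp_class w = (\<lambda>u. word_class (relabel f u)) ` {u. (u, w) \<in> graph_product_rel H X}"
    unfolding gp_class_conv[OF w] image_image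
    by (intro image_cong HOL.refl word_class_relabel[OF f g inv]) (auto dest: graph_product_rel_words)
  also have "\<dots> = word_class ` relabel f ` {u. (u, w) \<in> graph_product_rel H X}"
    by (simp only: image_image)
  also have "relabel f ` {u. (u, w) \<in> graph_product_rel H X} = {u. (u, relabel f w) \<in> graph_product_rel H X}"
  proof (intro equalityI subsetI)
    fix z assume "z \<in> relabel f ` {u. (u, w) \<in> graph_product_rel H X}"
    then show "z \<in> {u. (u, relabel f w) \<in> graph_product_rel H X}"
      using graph_product_rel_relabel[OF f arcs(1)] by auto
  next
    fix z assume "z \<in> {u. (u, relabel f w) \<in> graph_product_rel H X}"
    then have z: "(z, relabel f w) \<in> graph_product_rel H X" by simp
    then have "z \<in> W" using graph_product_rel_words by auto
    then have "z = relabel f (relabel g z)"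
      using relabel_cong[of z f g id] relabel_ident[of z id] inv(1) by simp
    moreover have "relabel g (relabel f w) = w"
      using relabel_cong[of w g f id] relabel_ident[of w id] inv(2) w by simp
    then have "relabel g z \<in> {u. (u, w) \<in> graph_product_rel H X}"
      using graph_product_rel_relabel[OF g arcs(2) z] by simp
    ultimately show "z \<in> relabel f ` {u. (u, w) \<in> graph_product_rel H X}" by (rule image_eqI)
  qed
  also have "word_class ` {u. (u, relabel f w) \<in> graph_product_rel H X} = gp_class (relabel f w)"
    by (rule gp_class_conv[OF relabel_closed[OF f w], symmetric])
  finally show ?thesis .
qed

end

section \<open>LEF groups: change of the finite type, and subgroups\<close>

text \<open>\<open>LEF_group\<close> speaks of finite groups on natural numbers, whereas
  permutations of states have another type. Transport of structure along an injection into the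
  naturals bridges the gap.\<close>

lemma LEF_groupI:
  assumes "group G"
    and "\<And>A. finite A \<Longrightarrow> A \<subseteq> carrier G \<Longrightarrow>
      \<exists>(Q :: 'q monoid) \<phi>. group Q \<and> finite (carrier Q) \<and> \<phi> \<in> A \<rightarrow> carrier Q \<and> inj_on \<phi> A \<and>
        (\<forall>g\<in>A. \<forall>h\<in>A. g \<otimes>\<^bsub>G\<^esub> h \<in> A \<longrightarrow> \<phi> (g \<otimes>\<^bsub>G\<^esub> h) = \<phi> g \<otimes>\<^bsub>Q\<^esub> \<phi> h)"
  shows "LEF_group G"
  unfolding LEF_group_def
proof (intro conjI allI impI)
  fix A assume "finite A \<and> A \<subseteq> carrier G"
  then obtain Q :: "'q monoid" and \<phi> where Q: "group Q" "finite (carrier Q)" and \<phi>: "\<phi> \<in> A \<rightarrow> carrier Q" "inj_on \<phi> A"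
    and hom: "\<And>g h. g \<in> A \<Longrightarrow> h \<in> A \<Longrightarrow> g \<otimes>\<^bsub>G\<^esub> h \<in> A \<Longrightarrow> \<phi> (g \<otimes>\<^bsub>G\<^esub> h) = \<phi> g \<otimes>\<^bsub>Q\<^esub> \<phi> h"
    using assms(2) by metis
  obtain f :: "'q \<Rightarrow> nat" where f: "inj_on f (carrier Q)"
    using finite_imp_inj_to_nat_seg[OF Q(2)] by blast
  interpret Q: group Q by fact
  define f' where "f' = inv_into (carrier Q) f"
  have f': "f' (f x) = x" if "x \<in> carrier Q" for x
    using f that by (simp add: f'_def)
  define R where "R = \<lparr>carrier = f ` carrier Q, monoid.mult = (\<lambda>x y. f (f' x \<otimes>\<^bsub>Q\<^esub> f' y)), one = f \<one>\<^bsub>Q\<^esub>\<rparr>"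
  have "group R"
  proof (rule groupI)
    fix x assume "x \<in> carrier R"
    then obtain y where "x = f y" "y \<in> carrier Q" by (auto simp: R_def)
    then show "\<exists>z\<in>carrier R. z \<otimes>\<^bsub>R\<^esub> x = \<one>\<^bsub>R\<^esub>"
      by (intro bexI[of _ "f (inv\<^bsub>Q\<^esub> y)"]) (auto simp: R_def f')
  qed (auto simp: R_def f' Q.m_assoc)
  moreover have "inj_on (f \<circ> \<phi>) A"
    using \<phi> f by (metis comp_inj_on inj_on_subset image_subset_iff_funcset)
  ultimately show "\<exists>(Q :: nat monoid) \<phi>. group Q \<and> finite (carrier Q) \<and> \<phi> \<in> A \<rightarrow> carrier Q \<and> inj_on \<phi> A \<and>
        (\<forall>g\<in>A. \<forall>h\<in>A. g \<otimes>\<^bsub>G\<^esub> h \<in> A \<longrightarrow> \<phi> (g \<otimes>\<^bsub>G\<^esub> h) = \<phi> g \<otimes>\<^bsub>Q\<^esub> \<phi> h)"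
    using Q(2) \<phi>(1) hom f' by (intro exI[of _ R] exI[of _ "f \<circ> \<phi>"]) (auto simp: R_def Pi_iff)
qed fact

lemma LEF_groupD:
  fixes G :: "('a, 'b) monoid_scheme"
  assumes "LEF_group G" "finite A" "A \<subseteq> carrier G"
  obtains Q :: "nat monoid" and \<phi> where "group Q" "finite (carrier Q)" "\<phi> \<in> A \<rightarrow> carrier Q" "inj_on \<phi> A"
    "\<And>g h. g \<in> A \<Longrightarrow> h \<in> A \<Longrightarrow> g \<otimes>\<^bsub>G\<^esub> h \<in> A \<Longrightarrow> \<phi> (g \<otimes>\<^bsub>G\<^esub> h) = \<phi> g \<otimes>\<^bsub>Q\<^esub> \<phi> h"
  using assms unfolding LEF_group_def by metis

lemma LEF_actionD:
  fixes \<Gamma> :: "('g, 'c) monoid_scheme"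
  assumes "LEF_action \<Gamma> X \<alpha>" "finite F" "F \<subseteq> carrier \<Gamma>" "finite Z" "Z \<subseteq> pverts X"
  obtains Q :: "nat monoid" and Y :: "nat pair_pre_digraph" and \<beta> \<rho> \<pi> where
    "group Q" "finite (carrier Q)" "pair_graph Y" "graph_action Q Y \<beta>"
    "\<rho> \<in> carrier \<Gamma> \<rightarrow> carrier Q" "\<pi> \<in> Z \<rightarrow> pverts Y" "inj_on \<pi> Z"
    "\<And>v w. v \<in> Z \<Longrightarrow> w \<in> Z \<Longrightarrow> (\<pi> v, \<pi> w) \<in> parcs Y \<longleftrightarrow> (v, w) \<in> parcs X"
    "\<And>g h. g \<in> F \<Longrightarrow> h \<in> F \<Longrightarrow> g \<otimes>\<^bsub>\<Gamma>\<^esub> h \<in> F \<Longrightarrow> \<rho> (g \<otimes>\<^bsub>\<Gamma>\<^esub> h) = \<rho> g \<otimes>\<^bsub>Q\<^esub> \<rho> h"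
    "\<And>g v. g \<in> F \<Longrightarrow> v \<in> Z \<Longrightarrow> \<alpha> g v \<in> Z \<Longrightarrow> \<pi> (\<alpha> g v) = \<beta> (\<rho> g) (\<pi> v)"
proof -
  have "finite F \<and> F \<subseteq> carrier \<Gamma> \<and> finite Z \<and> Z \<subseteq> pverts X" using assms by simp
  from conjunct2[OF assms(1)[unfolded LEF_action_def], rule_format, OF this]
  show thesis
    by (elim exE conjE, intro that) (assumption | simp)+
qed

lemma LEF_group_embedding:
  assumes "group G" "LEF_group K" "f \<in> hom G K" "inj_on f (carrier G)"
  shows "LEF_group G"
proof (rule LEF_groupI[OF assms(1)])
  fix A assume A: "finite A" "A \<subseteq> carrier G"
  then have "f ` A \<subseteq> carrier K" using assms(3) by (auto simp: hom_def)
  with A obtain Q :: "nat monoid" and \<phi> where Q: "group Q" "finite (carrier Q)" "\<phi> \<in> f ` A \<rightarrow> carrier Q"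
    "inj_on \<phi> (f ` A)"
    and hom: "\<And>g h. g \<in> f ` A \<Longrightarrow> h \<in> f ` A \<Longrightarrow> g \<otimes>\<^bsub>K\<^esub> h \<in> f ` A \<Longrightarrow> \<phi> (g \<otimes>\<^bsub>K\<^esub> h) = \<phi> g \<otimes>\<^bsub>Q\<^esub> \<phi> h"
    using LEF_groupD[OF assms(2), of "f ` A"] by (metis finite_imageI)
  have "inj_on (\<phi> \<circ> f) A"
    using assms(4) A Q(4) by (metis comp_inj_on inj_on_subset)
  moreover have "(\<phi> \<circ> f) (g \<otimes>\<^bsub>G\<^esub> h) = (\<phi> \<circ> f) g \<otimes>\<^bsub>Q\<^esub> (\<phi> \<circ> f) h" if "g \<in> A" "h \<in> A" "g \<otimes>\<^bsub>G\<^esub> h \<in> A" for g h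
  proof -
    have "f (g \<otimes>\<^bsub>G\<^esub> h) = f g \<otimes>\<^bsub>K\<^esub> f h" using that A assms(3) by (auto intro: hom_mult)
    then show ?thesis using that hom[of "f g" "f h"] by (metis comp_apply image_eqI)
  qed
  ultimately show "\<exists>(Q :: nat monoid) \<phi>. group Q \<and> finite (carrier Q) \<and> \<phi> \<in> A \<rightarrow> carrier Q \<and> inj_on \<phi> A \<and>
        (\<forall>g\<in>A. \<forall>h\<in>A. g \<otimes>\<^bsub>G\<^esub> h \<in> A \<longrightarrow> \<phi> (g \<otimes>\<^bsub>G\<^esub> h) = \<phi> g \<otimes>\<^bsub>Q\<^esub> \<phi> h)"
    using Q by (intro exI[of _ Q] exI[of _ "\<phi> \<circ> f"]) (auto simp: Pi_iff)
qed

section \<open>The wreath product as pairs of a word class and an acting element\<close>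

locale graph_action_on_group_graph = group_graph H X + G: group \<Gamma>
  for H :: "('h, 'b) monoid_scheme" and X :: "'v pair_pre_digraph"
    and \<Gamma> :: "('g, 'c) monoid_scheme" +
  fixes \<alpha> :: "'g \<Rightarrow> 'v \<Rightarrow> 'v"
  assumes graph_action: "graph_action \<Gamma> X \<alpha>"
begin

sublocale A: group_action \<Gamma> "pverts X" \<alpha>
  using graph_action by (simp add: graph_action_def)

abbreviation "Wr \<equiv> graph_wreath_product \<Gamma> H X \<alpha>"

lemma action_arcs: "g \<in> carrier \<Gamma> \<Longrightarrow> (i, j) \<in> parcs X \<Longrightarrow> (\<alpha> g i, \<alpha> g j) \<in> parcs X"
  using graph_action arcs_verts unfolding graph_action_def by blast

lemma action_closed: "g \<in> carrier \<Gamma> \<Longrightarrow> \<alpha> g \<in> pverts X \<rightarrow> pverts X"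
  using A.element_image by blast

lemma action_mult:
  "g \<in> carrier \<Gamma> \<Longrightarrow> h \<in> carrier \<Gamma> \<Longrightarrow> v \<in> pverts X \<Longrightarrow> \<alpha> (g \<otimes>\<^bsub>\<Gamma>\<^esub> h) v = \<alpha> g (\<alpha> h v)"
  by (rule A.composition_rule)

lemma action_one: "v \<in> pverts X \<Longrightarrow> \<alpha> \<one>\<^bsub>\<Gamma>\<^esub> v = v"
  using fun_cong[OF A.id_eq_one, of v] by simp

lemma induced_action_class:
  assumes g: "g \<in> carrier \<Gamma>" and w: "w \<in> W"
  shows "induced_action \<alpha> g (gp_class w) = gp_class (relabel (\<alpha> g) w)"
proof -
  have "map_prod (\<alpha> g) id = (\<lambda>(v, h :: 'h). (\<alpha> g v, h))" by auto
  then have "induced_action \<alpha> g (gp_class w) = (\<lambda>A. relabel (\<alpha> g) ` A) ` gp_class w"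
    by (simp add: induced_action_def)
  also have "\<dots> = gp_class (relabel (\<alpha> g) w)"
    using g w
    by (intro gp_class_relabel[where g = "\<alpha> (inv\<^bsub>\<Gamma>\<^esub> g)"] action_closed action_arcs)
      (simp_all add: action_one flip: action_mult)
  finally show ?thesis .
qed

lemma Wr_carrier: "carrier Wr = {(gp_class w, g) | w g. w \<in> W \<and> g \<in> carrier \<Gamma>}"
  by (auto simp: graph_wreath_product_def semidirect_product_def graph_product_carrier)

lemma Wr_one: "\<one>\<^bsub>Wr\<^esub> = (gp_class [], \<one>\<^bsub>\<Gamma>\<^esub>)"
  by (simp add: graph_wreath_product_def semidirect_product_def graph_product_one)

lemma Wr_mult:
  assumes "u \<in> W" "w \<in> W" "g \<in> carrier \<Gamma>"
  shows "(gp_class u, g) \<otimes>\<^bsub>Wr\<^esub> (gp_class w, h) = (gp_class (u @ relabel (\<alpha> g) w), g \<otimes>\<^bsub>\<Gamma>\<^esub> h)"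
  using assms relabel_closed[OF action_closed[OF assms(3)] assms(2)]
  by (simp add: graph_wreath_product_def semidirect_product_def induced_action_class graph_product_mult)

lemma Wr_group: "group Wr"
proof (rule groupI)
  show "\<one>\<^bsub>Wr\<^esub> \<in> carrier Wr" by (auto simp: Wr_one Wr_carrier)
next
  fix a b assume "a \<in> carrier Wr" "b \<in> carrier Wr"
  then obtain u g w h where ab: "a = (gp_class u, g)" "b = (gp_class w, h)"
    "u \<in> W" "w \<in> W" "g \<in> carrier \<Gamma>" "h \<in> carrier \<Gamma>"
    by (auto simp: Wr_carrier)
  then have "u @ relabel (\<alpha> g) w \<in> W" by (simp add: relabel_closed action_closed)
  then show "a \<otimes>\<^bsub>Wr\<^esub> b \<in> carrier Wr" using ab by (auto simp: Wr_mult Wr_carrier)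
next
  fix a b c assume "a \<in> carrier Wr" "b \<in> carrier Wr" "c \<in> carrier Wr"
  then obtain u g v h w k where abc: "a = (gp_class u, g)" "b = (gp_class v, h)" "c = (gp_class w, k)"
    "u \<in> W" "v \<in> W" "w \<in> W" "g \<in> carrier \<Gamma>" "h \<in> carrier \<Gamma>" "k \<in> carrier \<Gamma>"
    by (auto simp: Wr_carrier)
  moreover from this have "relabel (\<alpha> g) (relabel (\<alpha> h) w) = relabel (\<alpha> (g \<otimes>\<^bsub>\<Gamma>\<^esub> h)) w"
    by (intro relabel_cong) (simp_all add: action_mult)
  ultimately show "a \<otimes>\<^bsub>Wr\<^esub> b \<otimes>\<^bsub>Wr\<^esub> c = a \<otimes>\<^bsub>Wr\<^esub> (b \<otimes>\<^bsub>Wr\<^esub> c)"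
    using relabel_closed[OF action_closed[of g], of v] relabel_closed[OF action_closed[of h], of w]
    by (simp add: Wr_mult G.m_assoc del: map_map)
next
  fix a assume "a \<in> carrier Wr"
  then obtain u g where a: "a = (gp_class u, g)" "u \<in> W" "g \<in> carrier \<Gamma>"
    by (auto simp: Wr_carrier)
  then show "\<one>\<^bsub>Wr\<^esub> \<otimes>\<^bsub>Wr\<^esub> a = a"
    by (simp add: Wr_one Wr_mult relabel_ident action_one)
  \<comment> \<open>The inverse of the pair is obtained by letting the inverse of \<open>g\<close>
    act on the inverse word: relabelling \<open>?v @ u\<close> along \<open>?f\<close> keeps it
    trivial.\<close>
  let ?f = "\<alpha> (inv\<^bsub>\<Gamma>\<^esub> g)" and ?v = "inv_word (\<lambda>_. H) u"
  have f: "?f \<in> pverts X \<rightarrow> pverts X" using a by (simp add: action_closed)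
  have v: "?v \<in> W" using a by (simp add: inv_word_closed)
  have "(relabel ?f (?v @ u), relabel ?f []) \<in> graph_product_rel H X"
    using a f by (intro graph_product_rel_relabel action_arcs free_product_rel_imp_graph_product_rel inv_word_cancel) auto
  then have "gp_class (relabel ?f ?v @ relabel ?f u) = gp_class []"
    using f v a relabel_closed by (subst gp_class_eq_iff) auto
  then have "(gp_class (relabel ?f ?v), inv\<^bsub>\<Gamma>\<^esub> g) \<otimes>\<^bsub>Wr\<^esub> a = \<one>\<^bsub>Wr\<^esub>"
    using a relabel_closed[OF f v] by (simp add: Wr_mult Wr_one)
  then show "\<exists>b\<in>carrier Wr. b \<otimes>\<^bsub>Wr\<^esub> a = \<one>\<^bsub>Wr\<^esub>"
    using relabel_closed[OF f v] a by (intro bexI) (auto simp: Wr_carrier)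
qed

section \<open>Necessity\<close>

text \<open>Height 2 is enough for the words of length at most two compared below; heaps serve there
  as an invariant that tells classes apart.\<close>

lemma eval_letter:
  assumes "x \<in> carrier H"
  shows "eval 2 [(i, x)] base j k = (if j = i \<and> k = 0 then x else \<one>\<^bsub>H\<^esub>)"
proof -
  have "level i base = 0" by (simp add: level_def base_def)
  then show ?thesis using assms by (simp add: act_def base_def)
qed

lemma gp_class_letter_inj:
  assumes "i \<in> pverts X" "x \<in> carrier H" "y \<in> carrier H" "gp_class [(i, x)] = gp_class [(i, y)]"
  shows "x = y"
proof -
  have "eval 2 [(i, x)] = eval 2 [(i, y)]"
    using assms by (intro eval_cong) (simp flip: gp_class_eq_iff)
  then have "eval 2 [(i, x)] base i 0 = eval 2 [(i, y)] base i 0" by simp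
  then show ?thesis using assms by (simp add: eval_letter del: eval_Cons)
qed

lemma gp_class_letter_vertex_inj:
  assumes "i \<in> pverts X" "j \<in> pverts X" "x \<in> carrier H" "x \<noteq> \<one>\<^bsub>H\<^esub>" "gp_class [(i, x)] = gp_class [(j, x)]"
  shows "i = j"
proof (rule ccontr)
  assume "i \<noteq> j"
  have "eval 2 [(i, x)] = eval 2 [(j, x)]"
    using assms by (intro eval_cong) (simp flip: gp_class_eq_iff)
  then have "eval 2 [(i, x)] base i 0 = eval 2 [(j, x)] base i 0" by simp
  then show False using assms \<open>i \<noteq> j\<close> by (simp add: eval_letter del: eval_Cons)
qed

text \<open>Whichever letter acts first takes the bottom position and forces the other above it, so
  the two heaps differ over \<open>i\<close> at height 0.\<close>

lemma gp_class_not_commute: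
  assumes "i \<in> pverts X" "j \<in> pverts X" "i \<noteq> j" "(i, j) \<notin> parcs X" "x \<in> carrier H" "x \<noteq> \<one>\<^bsub>H\<^esub>"
  shows "gp_class [(i, x), (j, x)] \<noteq> gp_class [(j, x), (i, x)]"
proof
  assume "gp_class [(i, x), (j, x)] = gp_class [(j, x), (i, x)]"
  then have "eval 2 [(i, x), (j, x)] = eval 2 [(j, x), (i, x)]"
    using assms by (intro eval_cong) (simp flip: gp_class_eq_iff)
  then have eq: "eval 2 [(i, x), (j, x)] base i 0 = eval 2 [(j, x), (i, x)] base i 0" by simp
  let ?\<sigma> = "eval 2 [(j, x)] base"
  note \<sigma> = eval_letter[OF assms(5), of j]
  have "level i ?\<sigma> \<noteq> 0"
  proof
    assume "level i ?\<sigma> = 0"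
    moreover have "j \<in> dependent i" using assms by (simp add: dependent_def)
    ultimately have "?\<sigma> j 0 = \<one>\<^bsub>H\<^esub>"
      by (intro above_level[of ?\<sigma> 1]) (auto simp: \<sigma> simp del: eval_Cons split: if_splits)
    then show False using assms by (simp add: \<sigma> del: eval_Cons)
  qed
  moreover have "eval 2 [(i, x), (j, x)] base i 0 = act 2 i x ?\<sigma> i 0" by simp
  ultimately have "eval 2 [(i, x), (j, x)] base i 0 = ?\<sigma> i 0"
    by (simp add: act_def del: eval_Cons)
  then have "eval 2 [(i, x), (j, x)] base i 0 = \<one>\<^bsub>H\<^esub>"
    using assms by (simp add: \<sigma> del: eval_Cons)
  moreover have "eval 2 [(j, x), (i, x)] base i 0 = act 2 j x (eval 2 [(i, x)] base) i 0" by simp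
  then have "eval 2 [(j, x), (i, x)] base i 0 = eval 2 [(i, x)] base i 0"
    using assms by (simp add: act_def del: eval_Cons)
  then have "eval 2 [(j, x), (i, x)] base i 0 = x"
    using assms by (simp add: eval_letter del: eval_Cons)
  ultimately show False using eq assms by simp
qed

lemma LEF_acting_group:
  assumes "LEF_group Wr"
  shows "LEF_group \<Gamma>"
proof (rule LEF_group_embedding[OF G.is_group assms])
  show "(\<lambda>g. (gp_class [], g)) \<in> hom \<Gamma> Wr"
    using words_Nil by (auto simp: hom_def Wr_carrier Wr_mult simp del: words_Nil)
qed (simp add: inj_on_def)

lemma LEF_vertex_group:
  assumes "LEF_group Wr" and i: "i \<in> pverts X"
  shows "LEF_group H"
proof (rule LEF_group_embedding[OF H.is_group assms(1)])
  have "gp_class [(i, x), (i, y)] = gp_class [(i, x \<otimes>\<^bsub>H\<^esub> y)]" if "x \<in> carrier H" "y \<in> carrier H" for x y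
    using that i graph_product_rel.mult[of "[]" X H "[]" i x y] by (subst gp_class_eq_iff) auto
  then show "(\<lambda>x. (gp_class [(i, x)], \<one>\<^bsub>\<Gamma>\<^esub>)) \<in> hom H Wr"
    using i by (auto simp: hom_def Wr_carrier Wr_mult action_one intro!: exI[of _ "[(i, _)]"])
  show "inj_on (\<lambda>x. (gp_class [(i, x)], \<one>\<^bsub>\<Gamma>\<^esub>)) (carrier H)"
    using i by (auto intro!: inj_onI dest: gp_class_letter_inj)
qed

lemma LEF_action_of_LEF:
  assumes LEF: "LEF_group Wr" and x: "x \<in> carrier H" "x \<noteq> \<one>\<^bsub>H\<^esub>"
  shows "LEF_action \<Gamma> X \<alpha>"
  unfolding LEF_action_def
proof (intro conjI graph_action allI impI, elim conjE)
  fix F Z assume F: "finite F" "F \<subseteq> carrier \<Gamma>" and Z: "finite Z" "Z \<subseteq> pverts X"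
  define emb where "emb v = (gp_class [(v, x)], \<one>\<^bsub>\<Gamma>\<^esub>)" for v
  define inc :: "'g \<Rightarrow> _" where "inc g = (gp_class [], g)" for g
  \<comment> \<open>Besides the images of \<open>F\<close> and \<open>Z\<close>, the set has to
    contain the products that get compared. At the vertex \<open>\<alpha> g v\<close> the third
    block gives the common value of \<open>inc g \<otimes> emb v\<close> and
    \<open>emb (\<alpha> g v) \<otimes> inc g\<close>; the fourth gives the products that decide
    adjacency.\<close>
  define A where "A = inc ` F \<union> emb ` Z \<union> (\<lambda>(v, g). (gp_class [(v, x)], g)) ` (Z \<times> F)
    \<union> (\<lambda>(v, w). (gp_class [(v, x), (w, x)], \<one>\<^bsub>\<Gamma>\<^esub>)) ` (Z \<times> Z)"
  have "finite A" using F Z by (simp add: A_def)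
  moreover have "A \<subseteq> carrier Wr"
  proof -
    have mem: "(gp_class w, g) \<in> carrier Wr" if "w \<in> W" "g \<in> carrier \<Gamma>" for w g
      using that Wr_carrier by blast
    show ?thesis
      using F(2) Z(2) x by (auto simp: A_def emb_def inc_def intro!: mem)
  qed
  ultimately obtain Q :: "nat monoid" and \<phi> where Q: "group Q" "finite (carrier Q)"
    and \<phi>: "\<phi> \<in> A \<rightarrow> carrier Q" "inj_on \<phi> A"
    and hom: "\<And>g h. g \<in> A \<Longrightarrow> h \<in> A \<Longrightarrow> g \<otimes>\<^bsub>Wr\<^esub> h \<in> A \<Longrightarrow> \<phi> (g \<otimes>\<^bsub>Wr\<^esub> h) = \<phi> g \<otimes>\<^bsub>Q\<^esub> \<phi> h"
    using LEF_groupD[OF LEF] by metis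
  interpret Q: group Q by fact
  \<comment> \<open>\<open>group_action\<close> asks for extensional permutations, hence the
    restricted abstraction.\<close>
  define \<beta> where "\<beta> = (\<lambda>g. \<lambda>h\<in>carrier Q. g \<otimes>\<^bsub>Q\<^esub> h \<otimes>\<^bsub>Q\<^esub> inv\<^bsub>Q\<^esub> g)"
  define Y where "Y = \<lparr>pverts = carrier Q,
    parcs = {(a, b). a \<in> carrier Q \<and> b \<in> carrier Q \<and> a \<noteq> b \<and> a \<otimes>\<^bsub>Q\<^esub> b = b \<otimes>\<^bsub>Q\<^esub> a}\<rparr>"
  \<comment> \<open>\<open>\<rho>\<close> has to be total on \<open>carrier \<Gamma>\<close>, while
    \<open>\<phi>\<close> is controlled on \<open>A\<close> only.\<close>
  define \<rho> where "\<rho> g = (if g \<in> F then \<phi> (inc g) else \<one>\<^bsub>Q\<^esub>)" for g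
  define \<pi> where "\<pi> v = \<phi> (emb v)" for v
  have embA: "emb v \<in> A" if "v \<in> Z" for v using that by (auto simp: A_def)
  have incA: "inc g \<in> A" if "g \<in> F" for g using that by (auto simp: A_def)
  have pairA: "(gp_class [(v, x), (w, x)], \<one>\<^bsub>\<Gamma>\<^esub>) \<in> A" if "v \<in> Z" "w \<in> Z" for v w
    using that by (auto simp: A_def)
  have \<rho>_closed: "\<rho> \<in> carrier \<Gamma> \<rightarrow> carrier Q"
    using funcset_mem[OF \<phi>(1) incA] by (simp add: \<rho>_def)
  have \<pi>_closed: "\<pi> v \<in> carrier Q" if "v \<in> Z" for v
    using funcset_mem[OF \<phi>(1) embA[OF that]] by (simp add: \<pi>_def)
  have "finite (parcs Y)"
    by (rule finite_subset[OF _ finite_cartesian_product[OF Q(2) Q(2)]]) (auto simp: Y_def)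
  then have Y: "pair_graph Y"
    using Q(2) by unfold_locales (auto simp: Y_def symmetric_def sym_def)
  have conj_comm: "\<beta> g a \<otimes>\<^bsub>Q\<^esub> \<beta> g b = \<beta> g (a \<otimes>\<^bsub>Q\<^esub> b)"
    if "g \<in> carrier Q" "a \<in> carrier Q" "b \<in> carrier Q" for g a b
    using that by (simp add: \<beta>_def Q.m_assoc Q.inv_solve_left')
  have act: "group_action Q (carrier Q) \<beta>"
    unfolding \<beta>_def by (rule Q.action_by_conjugation)
  interpret B: group_action Q "carrier Q" \<beta> by (rule act)
  have \<beta>_eq: "\<beta> g a = \<beta> g b \<longleftrightarrow> a = b"
    if "g \<in> carrier Q" "a \<in> carrier Q" "b \<in> carrier Q" for g a b
    using B.inj_prop[OF that(1)] that(2,3) by (auto dest: inj_onD)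
  have \<beta>_closed: "\<beta> g a \<in> carrier Q" if "g \<in> carrier Q" "a \<in> carrier Q" for g a
    using that by (simp add: \<beta>_def)
  have "(\<beta> g a, \<beta> g b) \<in> parcs Y \<longleftrightarrow> (a, b) \<in> parcs Y"
    if "g \<in> carrier Q" "a \<in> carrier Q" "b \<in> carrier Q" for g a b
    using that by (simp add: Y_def conj_comm \<beta>_eq \<beta>_closed)
  with act have \<beta>: "graph_action Q Y \<beta>"
    unfolding graph_action_def by (simp add: Y_def)
  have comm: "\<pi> v \<otimes>\<^bsub>Q\<^esub> \<pi> w = \<phi> (gp_class [(v, x), (w, x)], \<one>\<^bsub>\<Gamma>\<^esub>)" if "v \<in> Z" "w \<in> Z" for v w
  proof -
    have "emb v \<otimes>\<^bsub>Wr\<^esub> emb w = (gp_class [(v, x), (w, x)], \<one>\<^bsub>\<Gamma>\<^esub>)"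
      using subsetD[OF Z(2) that(1)] subsetD[OF Z(2) that(2)] x by (simp add: emb_def Wr_mult action_one)
    then show ?thesis using hom[of "emb v" "emb w"] embA pairA that by (simp add: \<pi>_def)
  qed
  have \<pi>_inj: "inj_on \<pi> Z"
  proof (rule inj_onI)
    fix v w assume vw: "v \<in> Z" "w \<in> Z" "\<pi> v = \<pi> w"
    then have "emb v = emb w" using \<phi>(2) embA unfolding \<pi>_def by (meson inj_onD)
    then show "v = w"
      using subsetD[OF Z(2) vw(1)] subsetD[OF Z(2) vw(2)] x
      by (intro gp_class_letter_vertex_inj[of v w x]) (simp_all add: emb_def)
  qed
  have \<pi>_arcs: "(\<pi> v, \<pi> w) \<in> parcs Y \<longleftrightarrow> (v, w) \<in> parcs X" if vw: "v \<in> Z" "w \<in> Z" for v w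
  proof -
    \<comment> \<open>Both products lie in \<open>A\<close>, where \<open>\<phi>\<close> is
      injective, so two vertices commute in \<open>Q\<close> only if they do so in the wreath
      product.\<close>
    have "\<pi> v \<otimes>\<^bsub>Q\<^esub> \<pi> w = \<pi> w \<otimes>\<^bsub>Q\<^esub> \<pi> v \<longleftrightarrow> gp_class [(v, x), (w, x)] = gp_class [(w, x), (v, x)]"
      unfolding comm[OF vw] comm[OF vw(2,1)]
      by (simp add: inj_on_eq_iff[OF \<phi>(2) pairA pairA] vw)
    moreover have "v \<noteq> w \<and> gp_class [(v, x), (w, x)] = gp_class [(w, x), (v, x)] \<longleftrightarrow> (v, w) \<in> parcs X"
      using gp_class_not_commute[of v w x] gp_class_swap[of v w x x] arcs_irrefl[of v]
        subsetD[OF Z(2) vw(1)] subsetD[OF Z(2) vw(2)] x by metis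
    moreover have "\<pi> v = \<pi> w \<longleftrightarrow> v = w" using \<pi>_inj vw by (rule inj_on_eq_iff)
    ultimately show ?thesis using \<pi>_closed[OF vw(1)] \<pi>_closed[OF vw(2)] by (simp add: Y_def)
  qed
  have \<rho>_hom: "\<rho> (g \<otimes>\<^bsub>\<Gamma>\<^esub> h) = \<rho> g \<otimes>\<^bsub>Q\<^esub> \<rho> h" if "g \<in> F" "h \<in> F" "g \<otimes>\<^bsub>\<Gamma>\<^esub> h \<in> F" for g h
  proof -
    have "inc g \<otimes>\<^bsub>Wr\<^esub> inc h = inc (g \<otimes>\<^bsub>\<Gamma>\<^esub> h)"
      using subsetD[OF F(2) that(1)] by (simp add: inc_def Wr_mult)
    then show ?thesis using that hom[of "inc g" "inc h"] incA by (simp add: \<rho>_def)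
  qed
  have \<pi>_equivariant: "\<pi> (\<alpha> g v) = \<beta> (\<rho> g) (\<pi> v)" if "g \<in> F" "v \<in> Z" "\<alpha> g v \<in> Z" for g v
  proof -
    let ?a = "(gp_class [(\<alpha> g v, x)], g)"
    have g: "g \<in> carrier \<Gamma>" "\<alpha> g v \<in> pverts X" "v \<in> pverts X" using that F Z by auto
    then have "inc g \<otimes>\<^bsub>Wr\<^esub> emb v = ?a" "emb (\<alpha> g v) \<otimes>\<^bsub>Wr\<^esub> inc g = ?a"
      using x by (simp_all add: inc_def emb_def Wr_mult)
    moreover have "?a \<in> A" using that by (auto simp: A_def)
    ultimately have "\<phi> (inc g) \<otimes>\<^bsub>Q\<^esub> \<phi> (emb v) = \<phi> (emb (\<alpha> g v)) \<otimes>\<^bsub>Q\<^esub> \<phi> (inc g)"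
      using hom[of "inc g" "emb v"] hom[of "emb (\<alpha> g v)" "inc g"] incA embA that by simp
    moreover have "\<rho> g \<in> carrier Q" using \<rho>_closed g by blast
    ultimately show ?thesis
      using that \<pi>_closed by (simp add: \<beta>_def \<rho>_def \<pi>_def Q.inv_solve_right)
  qed
  show "\<exists>(Q :: nat monoid) (Y :: nat pair_pre_digraph) \<beta> \<rho> \<pi>.
        group Q \<and> finite (carrier Q) \<and> pair_graph Y \<and> graph_action Q Y \<beta> \<and>
        \<rho> \<in> carrier \<Gamma> \<rightarrow> carrier Q \<and>
        \<pi> \<in> Z \<rightarrow> pverts Y \<and> inj_on \<pi> Z \<and>
        (\<forall>x\<in>Z. \<forall>y\<in>Z. (\<pi> x, \<pi> y) \<in> parcs Y \<longleftrightarrow> (x, y) \<in> parcs X) \<and>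
        (\<forall>g\<in>F. \<forall>h\<in>F. g \<otimes>\<^bsub>\<Gamma>\<^esub> h \<in> F \<longrightarrow> \<rho> (g \<otimes>\<^bsub>\<Gamma>\<^esub> h) = \<rho> g \<otimes>\<^bsub>Q\<^esub> \<rho> h) \<and>
        (\<forall>g\<in>F. \<forall>x\<in>Z. \<alpha> g x \<in> Z \<longrightarrow> \<pi> (\<alpha> g x) = \<beta> (\<rho> g) (\<pi> x))"
  proof (intro exI conjI ballI impI)
    show "\<pi> \<in> Z \<rightarrow> pverts Y" using \<pi>_closed by (auto simp: Y_def)
  qed (fact Q Y \<beta> \<rho>_closed \<pi>_inj \<pi>_arcs \<rho>_hom \<pi>_equivariant)+
qed

section \<open>Sufficiency\<close>

lemma Wr_rep:
  assumes "a \<in> carrier Wr"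
  shows "\<exists>w\<in>W. fst a = gp_class w" and "snd a \<in> carrier \<Gamma>"
  using assms by (auto simp: Wr_carrier)

lemma inv_word_append_cancel:
  assumes "u \<in> W" "w \<in> W"
  shows "(w, u @ inv_word (\<lambda>_. H) u @ w) \<in> graph_product_rel H X"
proof -
  have v: "inv_word (\<lambda>_. H) u \<in> W" using assms by (simp add: inv_word_closed)
  have "word_class (u @ inv_word (\<lambda>_. H) u) = word_class []"
    using assms v P.r_inv[of "word_class u"]
    by (simp add: free_product_inv free_product_mult free_product_one)
  then have "(u @ inv_word (\<lambda>_. H) u, []) \<in> free_product_rel (pverts X) (\<lambda>_. H)"
    using assms v by (subst (asm) word_class_eq_iff) auto
  then have "([] @ u @ inv_word (\<lambda>_. H) u @ w, [] @ [] @ w) \<in> graph_product_rel H X"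
    using graph_product_rel_context[OF free_product_rel_imp_graph_product_rel, of "u @ inv_word (\<lambda>_. H) u" "[]" "[]" w] assms
    by simp
  then show ?thesis by (simp add: graph_product_rel.sym)
qed

text \<open>The pair of a word and \<open>g\<close> is sent to the transport along
  \<open>\<beta> (\<rho> g)\<close> followed by evaluation of the renamed word, together with
  \<open>\<mu> g\<close>. Products are respected by equivariance; injectivity is read off at
  \<open>base\<close>, which every transport fixes.\<close>

lemma LEF_graph_wreath_product:
  assumes LEF_G: "LEF_group \<Gamma>" and LEF_H: "LEF_group H" and LEF_act: "LEF_action \<Gamma> X \<alpha>"
    and nonempty: "pverts X \<noteq> {}"
  shows "LEF_group Wr"
proof (rule LEF_groupI[OF Wr_group, where 'q = "((nat \<Rightarrow> nat \<Rightarrow> nat) \<Rightarrow> nat \<Rightarrow> nat \<Rightarrow> nat) \<times> nat"])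
  fix A assume A: "finite A" "A \<subseteq> carrier Wr"
  have "\<forall>a\<in>A. \<exists>w\<in>W. fst a = gp_class w" using A(2) Wr_rep(1) by blast
  then obtain wd where wd: "\<And>a. a \<in> A \<Longrightarrow> wd a \<in> W" "\<And>a. a \<in> A \<Longrightarrow> fst a = gp_class (wd a)"
    by (metis bchoice)
  have snd_A: "snd a \<in> carrier \<Gamma>" if "a \<in> A" for a using A(2) that Wr_rep(2) by blast
  \<comment> \<open>A reduced word for the difference of two elements in the graph product. If it is
    empty, their word components agree; otherwise it moves the empty heap in every good
    approximation.\<close>
  define df where "df a b = (SOME r. (inv_word (\<lambda>_. H) (wd a) @ wd b, r) \<in> graph_product_rel H X \<and> reduced r)" for a b
  have df: "(inv_word (\<lambda>_. H) (wd a) @ wd b, df a b) \<in> graph_product_rel H X" "reduced (df a b)"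
    if "a \<in> A" "b \<in> A" for a b
    using someI_ex[OF ex_reduced[of "inv_word (\<lambda>_. H) (wd a) @ wd b"]] wd that inv_word_closed
    unfolding df_def by auto
  have df_W: "df a b \<in> W" if "a \<in> A" "b \<in> A" for a b
    using df(1)[OF that] graph_product_rel_words by blast
  have df_rel: "(wd b, wd a @ df a b) \<in> graph_product_rel H X" if "a \<in> A" "b \<in> A" for a b
    using inv_word_append_cancel[OF wd(1)[OF that(1)] wd(1)[OF that(2)]]
      graph_product_rel_context[OF df(1)[OF that], of "wd a" "[]"] wd(1)[OF that(1)]
    by (auto intro: graph_product_rel.trans)
  define prod where "prod a b = wd a @ relabel (\<alpha> (snd a)) (wd b)" for a b
  have rl_W: "relabel (\<alpha> (snd a)) (wd b) \<in> W" if "a \<in> A" "b \<in> A" for a b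
    using that wd snd_A by (intro relabel_closed action_closed) auto
  have mult_eq: "a \<otimes>\<^bsub>Wr\<^esub> b = (gp_class (prod a b), snd a \<otimes>\<^bsub>\<Gamma>\<^esub> snd b)" if "a \<in> A" "b \<in> A" for a b
    using Wr_mult[OF wd(1)[OF that(1)] wd(1)[OF that(2)] snd_A[OF that(1)], of "snd b"]
    by (simp add: prod_def flip: wd(2)[OF that(1)] wd(2)[OF that(2)])
  have prod_rel: "(wd (a \<otimes>\<^bsub>Wr\<^esub> b), prod a b) \<in> graph_product_rel H X"
    if "a \<in> A" "b \<in> A" "a \<otimes>\<^bsub>Wr\<^esub> b \<in> A" for a b
  proof -
    have "prod a b \<in> W" using that wd rl_W by (simp add: prod_def)
    moreover have "gp_class (wd (a \<otimes>\<^bsub>Wr\<^esub> b)) = gp_class (prod a b)"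
      using wd(2)[OF that(3)] mult_eq[OF that(1,2)] by simp
    ultimately show ?thesis using wd(1)[OF that(3)] by (simp add: gp_class_eq_iff)
  qed
  define R where "R = {(a, b). a \<in> A \<and> b \<in> A \<and> a \<otimes>\<^bsub>Wr\<^esub> b \<in> A}"
  \<comment> \<open>All equalities that must survive the approximation: those that express
    \<open>wd b\<close> through \<open>wd a\<close> and the difference, for injectivity, and the
    multiplication table of \<open>A\<close>.\<close>
  define E where "E = (\<lambda>(a, b). (wd b, wd a @ df a b)) ` (A \<times> A) \<union> (\<lambda>(a, b). (wd (a \<otimes>\<^bsub>Wr\<^esub> b), prod a b)) ` R"
  have "finite R" by (rule finite_subset[OF _ finite_cartesian_product[OF A(1) A(1)]]) (auto simp: R_def)
  then have "finite E" using A(1) by (simp add: E_def)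
  moreover have E_rel: "(fst p, snd p) \<in> graph_product_rel H X" if "p \<in> E" for p
    using that df_rel prod_rel by (auto simp: E_def R_def)
  ultimately have ev_eval: "\<forall>\<^sub>F B in finite_subsets_at_top (pverts X \<times> carrier H). \<forall>p\<in>E.
    \<forall>(L :: nat monoid) (Y :: nat pair_pre_digraph) \<pi> \<psi> n. local_embedding H X B L Y \<pi> \<psi> \<longrightarrow>
      group_graph.eval L Y n (map (map_prod \<pi> \<psi>) (fst p)) = group_graph.eval L Y n (map (map_prod \<pi> \<psi>) (snd p))"
    by (intro eventually_ball_finite ballI eventually_eval_eq)
  obtain v0 where v0: "v0 \<in> pverts X" using nonempty by blast
  \<comment> \<open>The letter at \<open>v0\<close> puts the identity among the group elements of
    \<open>B\<close>, as \<open>local_embedding_reduced\<close> requires. The relabelled words are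
    included so that equivariance applies to every vertex of \<open>wd b\<close>.\<close>
  define C where "C = {(v0, \<one>\<^bsub>H\<^esub>)} \<union> (\<Union>a\<in>A. set (wd a)) \<union> (\<Union>a\<in>A. \<Union>b\<in>A. set (df a b)) \<union>
    (\<Union>a\<in>A. \<Union>b\<in>A. set (relabel (\<alpha> (snd a)) (wd b)))"
  have "finite C" using A(1) by (auto simp: C_def)
  moreover have "C \<subseteq> pverts X \<times> carrier H"
    using v0 wd(1) df_W rl_W unfolding C_def words_iff_set by blast
  ultimately have "\<forall>\<^sub>F B in finite_subsets_at_top (pverts X \<times> carrier H).
      finite B \<and> C \<subseteq> B \<and> B \<subseteq> pverts X \<times> carrier H"
    unfolding eventually_finite_subsets_at_top by (intro exI[of _ C]) simp
  \<comment> \<open>The filter is proper, so one finite \<open>B\<close> serves all of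
    \<open>E\<close>, before any approximation has been chosen.\<close>
  from eventually_happens'[OF finite_subsets_at_top_neq_bot eventually_conj[OF ev_eval this]]
  obtain B where B_eval: "\<forall>p\<in>E. \<forall>(L :: nat monoid) (Y :: nat pair_pre_digraph) \<pi> \<psi> n. local_embedding H X B L Y \<pi> \<psi> \<longrightarrow>
      group_graph.eval L Y n (map (map_prod \<pi> \<psi>) (fst p)) = group_graph.eval L Y n (map (map_prod \<pi> \<psi>) (snd p))"
    and B: "finite B" "C \<subseteq> B" "B \<subseteq> pverts X \<times> carrier H"
    by (elim exE conjE)
  note eval_eq = B_eval[rule_format]
  define F Z K where "F = snd ` A" and "Z = fst ` B" and "K = snd ` B"
  have F: "finite F" "F \<subseteq> carrier \<Gamma>" and Z: "finite Z" "Z \<subseteq> pverts X" and K: "finite K" "K \<subseteq> carrier H"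
    using A(1) snd_A B by (auto simp: F_def Z_def K_def)
  obtain Q :: "nat monoid" and Y :: "nat pair_pre_digraph" and \<beta> \<rho> \<pi> where
    Q: "group Q" "finite (carrier Q)" and Y: "pair_graph Y" and \<beta>: "graph_action Q Y \<beta>"
    and \<rho>: "\<rho> \<in> carrier \<Gamma> \<rightarrow> carrier Q" and \<pi>: "\<pi> \<in> Z \<rightarrow> pverts Y" "inj_on \<pi> Z"
    and \<pi>_arcs: "\<And>v w. v \<in> Z \<Longrightarrow> w \<in> Z \<Longrightarrow> (\<pi> v, \<pi> w) \<in> parcs Y \<longleftrightarrow> (v, w) \<in> parcs X"
    and \<rho>_hom: "\<And>g h. g \<in> F \<Longrightarrow> h \<in> F \<Longrightarrow> g \<otimes>\<^bsub>\<Gamma>\<^esub> h \<in> F \<Longrightarrow> \<rho> (g \<otimes>\<^bsub>\<Gamma>\<^esub> h) = \<rho> g \<otimes>\<^bsub>Q\<^esub> \<rho> h"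
    and equivariant: "\<And>g v. g \<in> F \<Longrightarrow> v \<in> Z \<Longrightarrow> \<alpha> g v \<in> Z \<Longrightarrow> \<pi> (\<alpha> g v) = \<beta> (\<rho> g) (\<pi> v)"
    by (rule LEF_actionD[OF LEF_act F Z]) (rule that)
  obtain L :: "nat monoid" and \<psi> where L: "group L" "finite (carrier L)"
    and \<psi>: "\<psi> \<in> K \<rightarrow> carrier L" "inj_on \<psi> K"
    "\<And>x y. x \<in> K \<Longrightarrow> y \<in> K \<Longrightarrow> x \<otimes>\<^bsub>H\<^esub> y \<in> K \<Longrightarrow> \<psi> (x \<otimes>\<^bsub>H\<^esub> y) = \<psi> x \<otimes>\<^bsub>L\<^esub> \<psi> y"
    using LEF_groupD[OF LEF_H K] by metis
  obtain M :: "nat monoid" and \<mu> where M: "group M" "finite (carrier M)"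
    and \<mu>: "\<mu> \<in> F \<rightarrow> carrier M" "inj_on \<mu> F"
    "\<And>g h. g \<in> F \<Longrightarrow> h \<in> F \<Longrightarrow> g \<otimes>\<^bsub>\<Gamma>\<^esub> h \<in> F \<Longrightarrow> \<mu> (g \<otimes>\<^bsub>\<Gamma>\<^esub> h) = \<mu> g \<otimes>\<^bsub>M\<^esub> \<mu> h"
    using LEF_groupD[OF LEF_G F] by metis
  interpret Yg: pair_graph Y by (rule Y)
  interpret Q: group Q by (rule Q(1))
  interpret L: group L by (rule L(1))
  interpret Y: graph_action_on_group_graph L Y Q \<beta>
    by unfold_locales (rule \<beta>)
  have emb: "local_embedding H X B L Y \<pi> \<psi>"
    unfolding local_embedding_def
    using Y.group_graph_axioms \<pi> \<psi> \<pi>_arcs by (auto simp: Z_def[symmetric] K_def[symmetric])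
  define ren where "ren = map (map_prod \<pi> \<psi>)"
  have ren_append: "ren (u @ w) = ren u @ ren w" for u w by (simp add: ren_def)
  have ren_W: "ren w \<in> Y.W" if "set w \<subseteq> B" for w
    using that \<pi>(1) \<psi>(1) unfolding words_iff_set by (force simp: ren_def Z_def K_def)
  have wd_B: "set (wd a) \<subseteq> B" if "a \<in> A" for a
    using that B(2) unfolding C_def by blast
  have df_B: "set (df a b) \<subseteq> B" if "a \<in> A" "b \<in> A" for a b
    using that B(2) unfolding C_def by blast
  have rl_B: "set (relabel (\<alpha> (snd a)) (wd b)) \<subseteq> B" if "a \<in> A" "b \<in> A" for a b
    using B(2) UN_I[OF that(1) UN_I[OF that(2)], of _ "\<lambda>a b. set (relabel (\<alpha> (snd a)) (wd b))"]
    unfolding C_def by (meson UnI2 subsetD subsetI)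
  \<comment> \<open>Only the differences have to fit below height \<open>n\<close>; the relations
    hold for every truncation.\<close>
  have "\<exists>n. \<forall>p\<in>A \<times> A. length (case_prod df p) \<le> n"
    using A(1) by (intro exI[of _ "Max ((length \<circ> case_prod df) ` (A \<times> A))"] ballI Max_ge) auto
  then obtain n where n: "\<And>a b. a \<in> A \<Longrightarrow> b \<in> A \<Longrightarrow> length (df a b) \<le> n" by auto
  let ?S = "Y.states n"
  define \<tau> where "\<tau> a = Y.eval n (ren (wd a)) \<circ> Y.transport (\<beta> (\<rho> (snd a)))" for a
  define \<Phi> where "\<Phi> a = (restrict (\<tau> a) ?S, \<mu> (snd a))" for a
  have snd_F: "snd a \<in> F" if "a \<in> A" for a using that by (simp add: F_def)
  have \<rho>A: "\<rho> (snd a) \<in> carrier Q" if "a \<in> A" for a using that \<rho> snd_A by blast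
  have bij_\<beta>: "bij_betw (\<beta> q) (pverts Y) (pverts Y)" if "q \<in> carrier Q" for q
    using Y.A.bij_prop0[OF that] by (simp add: Bij_def)
  have bij_\<tau>: "bij_betw (\<tau> a) ?S ?S" if "a \<in> A" for a
    unfolding \<tau>_def
    by (rule bij_betw_trans[OF Y.bij_transport Y.bij_eval]) (use that bij_\<beta> \<rho>A ren_W wd_B in auto)
  have \<tau>_mult: "\<tau> (a \<otimes>\<^bsub>Wr\<^esub> b) \<sigma> = \<tau> a (\<tau> b \<sigma>)" if ab: "a \<in> A" "b \<in> A" "a \<otimes>\<^bsub>Wr\<^esub> b \<in> A" for a b \<sigma>
  proof -
    let ?f = "\<beta> (\<rho> (snd a))"
    have f: "bij_betw ?f (pverts Y) (pverts Y)" using bij_\<beta> \<rho>A ab by blast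
    have "(wd (a \<otimes>\<^bsub>Wr\<^esub> b), prod a b) \<in> E" using ab by (auto simp: E_def R_def)
    from eval_eq[OF this emb, of n]
    have 1: "Y.eval n (ren (wd (a \<otimes>\<^bsub>Wr\<^esub> b))) = Y.eval n (ren (prod a b))"
      by (simp add: ren_def)
    \<comment> \<open>Moving a letter by \<open>\<alpha>\<close> and then renaming it agrees with
      renaming it and then moving it by \<open>\<beta>\<close>, because both vertices lie in
      \<open>Z\<close>.\<close>
    have "map_prod \<pi> \<psi> (\<alpha> (snd a) v, x) = map_prod ?f id (map_prod \<pi> \<psi> (v, x))" if "(v, x) \<in> set (wd b)" for v x
    proof -
      have "(v, x) \<in> B" using that wd_B ab by blast
      moreover have "(\<alpha> (snd a) v, x) \<in> B" using that rl_B[OF ab(1,2)] by force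
      ultimately have "v \<in> Z" "\<alpha> (snd a) v \<in> Z" by (force simp: Z_def)+
      then show ?thesis using equivariant[OF snd_F[OF ab(1)]] by simp
    qed
    then have 2: "ren (relabel (\<alpha> (snd a)) (wd b)) = Y.relabel ?f (ren (wd b))"
      by (auto simp: ren_def)
    have snd_ab: "snd (a \<otimes>\<^bsub>Wr\<^esub> b) = snd a \<otimes>\<^bsub>\<Gamma>\<^esub> snd b" using mult_eq ab by simp
    then have "\<rho> (snd (a \<otimes>\<^bsub>Wr\<^esub> b)) = \<rho> (snd a) \<otimes>\<^bsub>Q\<^esub> \<rho> (snd b)"
      using \<rho>_hom snd_F ab by metis
    then have 3: "Y.transport (\<beta> (\<rho> (snd (a \<otimes>\<^bsub>Wr\<^esub> b)))) \<sigma> = Y.transport ?f (Y.transport (\<beta> (\<rho> (snd b))) \<sigma>)"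
      using Y.action_mult \<rho>A ab by (intro Y.transport_comp bij_\<beta>) auto
    have 4: "Y.eval n (Y.relabel ?f (ren (wd b))) (Y.transport ?f s) = Y.transport ?f (Y.eval n (ren (wd b)) s)" for s
    proof (rule Y.eval_transport[OF f])
      show "(?f i, ?f j) \<in> parcs Y \<longleftrightarrow> (i, j) \<in> parcs Y" if "i \<in> pverts Y" "j \<in> pverts Y" for i j
        using \<beta> that \<rho>A[OF ab(1)] unfolding graph_action_def by blast
      show "ren (wd b) \<in> Y.W" using ab wd_B ren_W by blast
    qed
    show ?thesis
      by (simp add: \<tau>_def 1 3 prod_def ren_append 2 4)
  qed
  let ?Q = "BijGroup ?S \<times>\<times> M"
  have "group ?Q" by (intro DirProd_group group_BijGroup M)
  moreover have "finite (carrier ?Q)"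
  proof -
    have fin: "finite ?S" using L(2) Yg.pair_finite_verts by (rule Y.finite_states[rotated])
    have "Bij ?S \<subseteq> ?S \<rightarrow>\<^sub>E ?S" by (auto simp: Bij_def bij_betw_def PiE_def)
    then have "finite (Bij ?S)" by (rule finite_subset) (intro finite_PiE fin)
    then show ?thesis using M(2) by (simp add: DirProd_def BijGroup_def)
  qed
  moreover have \<Phi>_closed: "\<Phi> \<in> A \<rightarrow> carrier ?Q"
    using bij_\<tau> \<mu>(1) snd_F by (auto simp: \<Phi>_def DirProd_def BijGroup_def Bij_def)
  moreover have "inj_on \<Phi> A"
  proof (rule inj_onI)
    fix a b assume ab: "a \<in> A" "b \<in> A" "\<Phi> a = \<Phi> b"
    then have "\<mu> (snd a) = \<mu> (snd b)" by (simp add: \<Phi>_def)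
    then have snd_eq: "snd a = snd b" using \<mu>(2) snd_F ab by (meson inj_onD)
    have "restrict (\<tau> a) ?S Y.base = restrict (\<tau> b) ?S Y.base" using ab by (simp add: \<Phi>_def)
    then have base_eq: "Y.eval n (ren (wd a)) Y.base = Y.eval n (ren (wd b)) Y.base"
      using Y.base_states[of n] by (simp add: \<tau>_def Y.transport_base)
    have "(wd b, wd a @ df a b) \<in> E" using ab by (auto simp: E_def)
    from eval_eq[OF this emb, of n]
    have "Y.eval n (ren (wd b)) = Y.eval n (ren (wd a @ df a b))" by (simp add: ren_def)
    with base_eq have eq: "Y.eval n (ren (wd a)) Y.base = Y.eval n (ren (wd a)) (Y.eval n (ren (df a b)) Y.base)"
      by (simp add: ren_append)
    \<comment> \<open>The common word \<open>wd a\<close> permutes the states and can be cancelled;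
      a difference that fixes the empty heap is then empty.\<close>
    have "Y.eval n (ren (df a b)) Y.base \<in> ?S"
      by (rule bij_betw_apply[OF Y.bij_eval[OF ren_W[OF df_B[OF ab(1,2)]]] Y.base_states])
    moreover have "inj_on (Y.eval n (ren (wd a))) ?S"
      by (rule bij_betw_imp_inj_on[OF Y.bij_eval[OF ren_W[OF wd_B[OF ab(1)]]]])
    ultimately have "Y.eval n (ren (df a b)) Y.base = Y.base"
      using eq Y.base_states by (metis inj_onD)
    moreover have "Y.reduced (ren (df a b))"
      unfolding ren_def
    proof (rule local_embedding_reduced[OF group_graph_axioms emb])
      have "(v0, \<one>\<^bsub>H\<^esub>) \<in> B" using B(2) by (auto simp: C_def)
      then show "\<one>\<^bsub>H\<^esub> \<in> snd ` B" by force
    qed (use df_B df(2) ab in auto)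
    ultimately have "ren (df a b) = []"
      using Y.eval_reduced_nontrivial[of "ren (df a b)" n] ren_W[OF df_B] n ab
      by (metis ren_def length_map)
    then have "(wd b, wd a) \<in> graph_product_rel H X"
      using df_rel[OF ab(1,2)] by (simp add: ren_def)
    then have "fst a = fst b"
      using wd ab by (metis gp_class_eq_iff)
    with snd_eq show "a = b" by (simp add: prod_eq_iff)
  qed
  moreover have "\<forall>a\<in>A. \<forall>b\<in>A. a \<otimes>\<^bsub>Wr\<^esub> b \<in> A \<longrightarrow> \<Phi> (a \<otimes>\<^bsub>Wr\<^esub> b) = \<Phi> a \<otimes>\<^bsub>?Q\<^esub> \<Phi> b"
  proof (intro ballI impI)
    fix a b assume ab: "a \<in> A" "b \<in> A" "a \<otimes>\<^bsub>Wr\<^esub> b \<in> A"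
    have "restrict (\<tau> a) ?S \<in> Bij ?S" "restrict (\<tau> b) ?S \<in> Bij ?S"
      using \<Phi>_closed ab by (auto simp: \<Phi>_def DirProd_def BijGroup_def)
    moreover have "restrict (\<tau> (a \<otimes>\<^bsub>Wr\<^esub> b)) ?S = compose ?S (restrict (\<tau> a) ?S) (restrict (\<tau> b) ?S)"
      using bij_\<tau>[OF ab(2)] \<tau>_mult[OF ab] by (auto simp: compose_def fun_eq_iff bij_betw_apply)
    moreover have "\<mu> (snd (a \<otimes>\<^bsub>Wr\<^esub> b)) = \<mu> (snd a) \<otimes>\<^bsub>M\<^esub> \<mu> (snd b)"
      using \<mu>(3) snd_F ab mult_eq by (metis snd_conv)
    ultimately show "\<Phi> (a \<otimes>\<^bsub>Wr\<^esub> b) = \<Phi> a \<otimes>\<^bsub>?Q\<^esub> \<Phi> b"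
      by (simp add: \<Phi>_def DirProd_def BijGroup_def)
  qed
  ultimately show "\<exists>(Q :: (((nat \<Rightarrow> nat \<Rightarrow> nat) \<Rightarrow> nat \<Rightarrow> nat \<Rightarrow> nat) \<times> nat) monoid) \<phi>. group Q \<and> finite (carrier Q) \<and> \<phi> \<in> A \<rightarrow> carrier Q \<and> inj_on \<phi> A \<and>
      (\<forall>g\<in>A. \<forall>h\<in>A. g \<otimes>\<^bsub>Wr\<^esub> h \<in> A \<longrightarrow> \<phi> (g \<otimes>\<^bsub>Wr\<^esub> h) = \<phi> g \<otimes>\<^bsub>Q\<^esub> \<phi> h)"
    by (intro exI[of _ ?Q] exI[of _ \<Phi>] conjI)
qed

end

theorem theorem6p19:
  fixes \<Gamma> :: "('g, 'c) monoid_scheme"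
    and H :: "('h, 'b) monoid_scheme"
    and X :: "'v pair_pre_digraph"
    and \<alpha> :: "'g \<Rightarrow> 'v \<Rightarrow> 'v"
  assumes "group \<Gamma>" and "group H" and "carrier H \<noteq> {\<one>\<^bsub>H\<^esub>}"
    and "pair_bidirected_digraph X" and "pverts X \<noteq> {}"
    and "graph_action \<Gamma> X \<alpha>"
  shows "LEF_group (graph_wreath_product \<Gamma> H X \<alpha>) \<longleftrightarrow>
    LEF_group \<Gamma> \<and> LEF_group H \<and> LEF_action \<Gamma> X \<alpha>"
proof -
  interpret graph_action_on_group_graph H X \<Gamma> \<alpha>
    using assms
    by (intro graph_action_on_group_graph.intro group_graph.intro graph_action_on_group_graph_axioms.intro)
  \<comment> \<open>The vertex gives a copy of \<open>H\<close> inside the wreath product; the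
    element \<open>x\<close> gives the letters whose commutation recovers the graph.\<close>
  obtain v where "v \<in> pverts X" using assms(5) by blast
  moreover obtain x where "x \<in> carrier H" "x \<noteq> \<one>\<^bsub>H\<^esub>"
    using assms(3) H.one_closed by blast
  ultimately show ?thesis
    using LEF_acting_group LEF_vertex_group LEF_action_of_LEF LEF_graph_wreath_product assms(5) by blast
qed

end
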